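(* Let $(F,P)$ be an almost biparacomplex structure on a manifold $M$, let $\nabla$ be its canonical connection and let $\nabla'$ be its well-adapted connection. If $(F,P)$ is a biparacomplex structure, then $\nabla=\nabla'$.
   Context: Manifolds and tensor fields are $C^\infty$. An almost biparacomplex structure on $M$ is a pair $(F,P)$ of tensor fields of type $(1,1)$ with $F^2=P^2=\mathrm{Id}$ and $F\circ P+P\circ F=0$. Put $T_F^{\pm}(M)=\ker(F\mp\mathrm{Id})$ and $T_P^{\pm}(M)=\ker(P\mp\mathrm{Id})$. The structure is biparacomplex if these four distributions are involutive. The canonical connection of $(F,P)$ is the unique linear connection $\nabla$ on $M$ such that $\nabla F=0=\nabla P$ and whose torsion $T$ satisfies $T(X,Y)=0$ for all $X\in T_F^+(M)$, $Y\in T_F^-(M)$. The well-adapted connection of $(F,P)$ is the unique linear connection $\nabla'$ on $M$ such that $\nabla'F=0=\nabla'P$ (i.e. $\nabla'$ is adapted to the $G$-structure defined by $(F,P)$) and $\mathrm{trace}\bigl(Y\mapsto S(T'(X,Y))\bigr)=0$ for every vector field $X$ on $M$ and every endomorphism field $S$ of $TM$ that is a section of the adjoint bundle of this $G$-structure, i.e. every $S$ commuting with $F$ and $P$, where $T'$ is the torsion of $\nabla'$. *)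

theory Defs
  imports "HOL-Analysis.Analysis" "HOL-Library.Function_Algebras"
begin

text \<open>Pointwise real vector space structure on functions; tangent vectors and vector fields
  are functions, so they can be added and scaled directly.\<close>

instantiation "fun" :: (type, real_vector) real_vector
begin

definition scaleR_fun :: "real \<Rightarrow> ('a \<Rightarrow> 'b) \<Rightarrow> 'a \<Rightarrow> 'b"
  where "scaleR_fun c f = (\<lambda>x. c *\<^sub>R f x)"

instance
  by standard (auto simp: scaleR_fun_def fun_eq_iff scaleR_add_right scaleR_add_left)

end

section \<open>Smooth manifolds\<close>

text \<open>Only meant for open \<open>S\<close> in a finite-dimensional domain, where \<open>C\<^sup>k\<^sup>+\<^sup>1\<close> amounts to
  differentiability together with all directional derivatives being \<open>C\<^sup>k\<close>.\<close>

primrec Ck_on :: "nat \<Rightarrow> 'a::euclidean_space set \<Rightarrow> ('a \<Rightarrow> 'b::real_normed_vector) \<Rightarrow> bool" where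
  "Ck_on 0 S f \<longleftrightarrow> continuous_on S f"
| "Ck_on (Suc k) S f \<longleftrightarrow> (\<forall>x\<in>S. f differentiable (at x)) \<and>
     (\<forall>v. Ck_on k S (\<lambda>x. frechet_derivative f (at x) v))"

definition smooth_on :: "'a::euclidean_space set \<Rightarrow> ('a \<Rightarrow> 'b::real_normed_vector) \<Rightarrow> bool"
  where "smooth_on S f \<longleftrightarrow> (\<forall>k. Ck_on k S f)"

text \<open>A chart is a pair \<open>(U, \<phi>)\<close>; values of \<open>\<phi>\<close> outside \<open>U\<close> are irrelevant. The underlying set of
  the manifold is the whole type \<open>'m\<close>. The atlas need not be maximal.\<close>

type_synonym ('m, 'e) atlas = "('m set \<times> ('m \<Rightarrow> 'e)) set"

definition is_chart :: "'m::topological_space set \<times> ('m \<Rightarrow> 'e::euclidean_space) \<Rightarrow> bool"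
  where "is_chart c \<longleftrightarrow> (case c of (U, \<phi>) \<Rightarrow>
     open U \<and> open (\<phi> ` U) \<and> homeomorphism U (\<phi> ` U) \<phi> (inv_into U \<phi>))"

definition smooth_manifold ::
  "('m::{t2_space, second_countable_topology}, 'e::euclidean_space) atlas \<Rightarrow> bool"
  where "smooth_manifold A \<longleftrightarrow>
     (\<forall>c\<in>A. is_chart c) \<and>
     (\<Union>(U, \<phi>)\<in>A. U) = UNIV \<and>
     (\<forall>(U, \<phi>)\<in>A. \<forall>(V, \<psi>)\<in>A. smooth_on (\<phi> ` (U \<inter> V)) (\<psi> \<circ> inv_into U \<phi>))"

definition smooth_functions :: "('m, 'e::euclidean_space) atlas \<Rightarrow> ('m \<Rightarrow> real) set"
  where "smooth_functions A = {f. \<forall>(U, \<phi>)\<in>A. smooth_on (\<phi> ` U) (f \<circ> inv_into U \<phi>)}"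

section \<open>Tangent vectors, vector fields and endomorphism fields\<close>

type_synonym 'm tvec = "('m \<Rightarrow> real) \<Rightarrow> real"
type_synonym 'm vfield = "'m \<Rightarrow> 'm tvec"
type_synonym 'm efield = "'m \<Rightarrow> 'm tvec \<Rightarrow> 'm tvec"

text \<open>Tangent vectors at \<open>p\<close> are the derivations at \<open>p\<close> of the algebra of smooth functions,
  made extensional by the value 0 on functions that are not smooth.\<close>

definition tangent_space :: "('m, 'e::euclidean_space) atlas \<Rightarrow> 'm \<Rightarrow> 'm tvec set"
  where "tangent_space A p = {v.
     (\<forall>f\<in>smooth_functions A. \<forall>g\<in>smooth_functions A. v (f + g) = v f + v g) \<and>
     (\<forall>c. \<forall>f\<in>smooth_functions A. v (c *\<^sub>R f) = c * v f) \<and>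
     (\<forall>f\<in>smooth_functions A. \<forall>g\<in>smooth_functions A. v (f * g) = v f * g p + f p * v g) \<and>
     (\<forall>f. f \<notin> smooth_functions A \<longrightarrow> v f = 0)}"

definition vector_fields :: "('m, 'e::euclidean_space) atlas \<Rightarrow> 'm vfield set"
  where "vector_fields A = {X. (\<forall>p. X p \<in> tangent_space A p) \<and>
     (\<forall>f\<in>smooth_functions A. (\<lambda>p. X p f) \<in> smooth_functions A)}"

definition lie_bracket :: "'m vfield \<Rightarrow> 'm vfield \<Rightarrow> 'm vfield"
  where "lie_bracket X Y = (\<lambda>p f. X p (\<lambda>q. Y q f) - Y p (\<lambda>q. X q f))"

definition endo_on :: "'v::real_vector set \<Rightarrow> ('v \<Rightarrow> 'v) \<Rightarrow> bool"
  where "endo_on V L \<longleftrightarrow> (\<forall>u\<in>V. L u \<in> V) \<and>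
     (\<forall>u\<in>V. \<forall>v\<in>V. L (u + v) = L u + L v) \<and> (\<forall>c. \<forall>u\<in>V. L (c *\<^sub>R u) = c *\<^sub>R L u)"

text \<open>Tensor fields of type (1,1): smoothness of the components is equivalent to mapping smooth
  vector fields to smooth vector fields.\<close>

definition apply_field :: "'m efield \<Rightarrow> 'm vfield \<Rightarrow> 'm vfield"
  where "apply_field E X = (\<lambda>p. E p (X p))"

definition endo_fields :: "('m, 'e::euclidean_space) atlas \<Rightarrow> 'm efield set"
  where "endo_fields A = {E. (\<forall>p. endo_on (tangent_space A p) (E p)) \<and>
     (\<forall>X\<in>vector_fields A. apply_field E X \<in> vector_fields A)}"

text \<open>Trace of an endomorphism of a finite-dimensional subspace \<open>V\<close>, computed in a basis of \<open>V\<close>.\<close>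

definition endo_trace :: "'v::real_vector set \<Rightarrow> ('v \<Rightarrow> 'v) \<Rightarrow> real"
  where "endo_trace V L =
     (let B = (SOME B. B \<subseteq> V \<and> independent B \<and> V \<subseteq> span B) in \<Sum>b\<in>B. representation B (L b) b)"

text \<open>A \<open>C\<^sup>\<infinity>\<close>-linear operator \<open>L\<close> on vector fields is a tensor field: \<open>L Y p\<close> depends on \<open>Y p\<close> only,
  so its value on a tangent vector \<open>v\<close> at \<open>p\<close> is computed with any vector field through \<open>v\<close>.\<close>

definition at_point ::
  "('m, 'e::euclidean_space) atlas \<Rightarrow> ('m vfield \<Rightarrow> 'm vfield) \<Rightarrow> 'm efield"
  where "at_point A L p v = L (SOME Y. Y \<in> vector_fields A \<and> Y p = v) p"

section \<open>Linear connections\<close>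

type_synonym 'm connection = "'m vfield \<Rightarrow> 'm vfield \<Rightarrow> 'm vfield"

definition linear_connection :: "('m, 'e::euclidean_space) atlas \<Rightarrow> 'm connection \<Rightarrow> bool"
  where "linear_connection A D \<longleftrightarrow>
     (\<forall>X\<in>vector_fields A. \<forall>Y\<in>vector_fields A. D X Y \<in> vector_fields A) \<and>
     (\<forall>X\<in>vector_fields A. \<forall>X'\<in>vector_fields A. \<forall>Y\<in>vector_fields A.
        D (X + X') Y = D X Y + D X' Y) \<and>
     (\<forall>X\<in>vector_fields A. \<forall>Y\<in>vector_fields A. \<forall>Y'\<in>vector_fields A.
        D X (Y + Y') = D X Y + D X Y') \<and>
     (\<forall>f\<in>smooth_functions A. \<forall>X\<in>vector_fields A. \<forall>Y\<in>vector_fields A.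
        D (\<lambda>p. f p *\<^sub>R X p) Y = (\<lambda>p. f p *\<^sub>R D X Y p)) \<and>
     (\<forall>f\<in>smooth_functions A. \<forall>X\<in>vector_fields A. \<forall>Y\<in>vector_fields A.
        D X (\<lambda>p. f p *\<^sub>R Y p) = (\<lambda>p. X p f *\<^sub>R Y p + f p *\<^sub>R D X Y p))"

definition torsion :: "'m connection \<Rightarrow> 'm vfield \<Rightarrow> 'm vfield \<Rightarrow> 'm vfield"
  where "torsion D X Y = D X Y - D Y X - lie_bracket X Y"

text \<open>\<open>(\<nabla>\<^sub>X E) Y\<close> for an endomorphism field \<open>E\<close>.\<close>

definition covariant_deriv_endo ::
  "'m connection \<Rightarrow> 'm efield \<Rightarrow> 'm vfield \<Rightarrow> 'm vfield \<Rightarrow> 'm vfield"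
  where "covariant_deriv_endo D E X Y = D X (apply_field E Y) - apply_field E (D X Y)"

definition parallel_endo ::
  "('m, 'e::euclidean_space) atlas \<Rightarrow> 'm connection \<Rightarrow> 'm efield \<Rightarrow> bool"
  where "parallel_endo A D E \<longleftrightarrow>
     (\<forall>X\<in>vector_fields A. \<forall>Y\<in>vector_fields A. covariant_deriv_endo D E X Y = 0)"

section \<open>Biparacomplex structures\<close>

definition almost_biparacomplex ::
  "('m, 'e::euclidean_space) atlas \<Rightarrow> 'm efield \<Rightarrow> 'm efield \<Rightarrow> bool"
  where "almost_biparacomplex A F P \<longleftrightarrow> F \<in> endo_fields A \<and> P \<in> endo_fields A \<and>
     (\<forall>p. \<forall>v\<in>tangent_space A p.
        F p (F p v) = v \<and> P p (P p v) = v \<and> F p (P p v) + P p (F p v) = 0)"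

text \<open>The distributions \<open>ker (E - Id)\<close> and \<open>ker (E + Id)\<close>.\<close>

definition plus_distribution ::
  "('m, 'e::euclidean_space) atlas \<Rightarrow> 'm efield \<Rightarrow> 'm \<Rightarrow> 'm tvec set"
  where "plus_distribution A E p = {v \<in> tangent_space A p. E p v - v = 0}"

definition minus_distribution ::
  "('m, 'e::euclidean_space) atlas \<Rightarrow> 'm efield \<Rightarrow> 'm \<Rightarrow> 'm tvec set"
  where "minus_distribution A E p = {v \<in> tangent_space A p. E p v + v = 0}"

definition sections ::
  "('m, 'e::euclidean_space) atlas \<Rightarrow> ('m \<Rightarrow> 'm tvec set) \<Rightarrow> 'm vfield set"
  where "sections A \<Delta> = {X \<in> vector_fields A. \<forall>p. X p \<in> \<Delta> p}"

definition involutive ::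
  "('m, 'e::euclidean_space) atlas \<Rightarrow> ('m \<Rightarrow> 'm tvec set) \<Rightarrow> bool"
  where "involutive A \<Delta> \<longleftrightarrow>
     (\<forall>X\<in>sections A \<Delta>. \<forall>Y\<in>sections A \<Delta>. lie_bracket X Y \<in> sections A \<Delta>)"

definition biparacomplex ::
  "('m, 'e::euclidean_space) atlas \<Rightarrow> 'm efield \<Rightarrow> 'm efield \<Rightarrow> bool"
  where "biparacomplex A F P \<longleftrightarrow> almost_biparacomplex A F P \<and>
     involutive A (plus_distribution A F) \<and> involutive A (minus_distribution A F) \<and>
     involutive A (plus_distribution A P) \<and> involutive A (minus_distribution A P)"

text \<open>The following two predicates are the defining properties of the canonical and of the
  well-adapted connection; that exactly one connection satisfies each is not built in.\<close>

definition canonical_connection ::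
  "('m, 'e::euclidean_space) atlas \<Rightarrow> 'm efield \<Rightarrow> 'm efield \<Rightarrow> 'm connection \<Rightarrow> bool"
  where "canonical_connection A F P D \<longleftrightarrow> linear_connection A D \<and>
     parallel_endo A D F \<and> parallel_endo A D P \<and>
     (\<forall>X\<in>sections A (plus_distribution A F). \<forall>Y\<in>sections A (minus_distribution A F).
        torsion D X Y = 0)"

definition adjoint_sections ::
  "('m, 'e::euclidean_space) atlas \<Rightarrow> 'm efield \<Rightarrow> 'm efield \<Rightarrow> 'm efield set"
  where "adjoint_sections A F P = {S \<in> endo_fields A. \<forall>p. \<forall>v\<in>tangent_space A p.
     S p (F p v) = F p (S p v) \<and> S p (P p v) = P p (S p v)}"

definition well_adapted_connection ::
  "('m, 'e::euclidean_space) atlas \<Rightarrow> 'm efield \<Rightarrow> 'm efield \<Rightarrow> 'm connection \<Rightarrow> bool"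
  where "well_adapted_connection A F P D \<longleftrightarrow> linear_connection A D \<and>
     parallel_endo A D F \<and> parallel_endo A D P \<and>
     (\<forall>X\<in>vector_fields A. \<forall>S\<in>adjoint_sections A F P. \<forall>p.
        endo_trace (tangent_space A p)
          (at_point A (\<lambda>Y. apply_field S (torsion D X Y)) p) = 0)"

end

theory Submission
  imports Defs
begin

text \<open>Let \<open>B(X, Y) = \<nabla>'\<^sub>X Y - \<nabla>\<^sub>X Y\<close>; it is a tensor commuting with \<open>F\<close> and \<open>P\<close> in \<open>Y\<close>.
  Involutivity of the four distributions makes \<open>\<nabla>\<close> torsion free: for \<open>X\<close>, \<open>Y\<close> in \<open>T\<^sub>F\<^sup>+\<close> the mixed terms
  vanish in \<open>T(X \<plusminus> P X, Y \<plusminus> P Y) = T(X, Y) + T(P X, P Y)\<close>, so this vector lies in \<open>T\<^sub>P\<^sup>+\<close> and in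
  \<open>T\<^sub>P\<^sup>-\<close>, hence is 0, and its two summands lie in \<open>T\<^sub>F\<^sup>+\<close> and \<open>T\<^sub>F\<^sup>-\<close>. Therefore
  \<open>T'(X, Y) = B(X, Y) - B(Y, X)\<close>. Averaging \<open>df \<otimes> W\<close> over the group generated by \<open>F\<close> and \<open>P\<close> gives
  sections of the adjoint bundle, for which the trace condition reads
  \<open>4 B(X, W) = B(W, X) + B(F W, F X) + B(P W, P X) - B(F P W, F P X)\<close>. If \<open>X\<close> and \<open>W\<close> lie in the same
  eigenbundle of \<open>F\<close>, this is \<open>4 B(X, W) = 2 B(W, X)\<close>, which forces \<open>B(X, W) = 0\<close>; the other case
  follows by applying \<open>P\<close> to \<open>W\<close>.

  The traces are those of derivations of the algebra of smooth functions. That these spaces are finite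
  dimensional, and that tensoriality may be used pointwise, comes from bump functions and Hadamard's lemma.\<close>

section \<open>Calculus of \<open>C\<^sup>k\<close> maps\<close>

lemma frechet_derivative_cong_on:
  assumes "open S" "x \<in> S" "\<And>y. y \<in> S \<Longrightarrow> f y = g y" "f differentiable (at x)"
  shows "g differentiable (at x)" "frechet_derivative g (at x) = frechet_derivative f (at x)"
proof -
  have "(f has_derivative frechet_derivative f (at x)) (at x)"
    using assms(4) by (simp add: frechet_derivative_works)
  then have *: "(g has_derivative frechet_derivative f (at x)) (at x)"
    by (rule has_derivative_transform_within_open[OF _ assms(1,2)]) (simp add: assms(3))
  show "g differentiable (at x)" using * by (rule differentiableI)
  show "frechet_derivative g (at x) = frechet_derivative f (at x)"
    using frechet_derivative_at[OF *] by simp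
qed

lemma Ck_on_cong:
  assumes "open S" "\<And>x. x \<in> S \<Longrightarrow> f x = g x" "Ck_on k S f"
  shows "Ck_on k S g"
  using assms(2,3)
proof (induction k arbitrary: f g)
  case 0
  then show ?case by (metis Ck_on.simps(1) continuous_on_cong)
next
  case (Suc k)
  have fg: "g differentiable (at x)" "frechet_derivative g (at x) = frechet_derivative f (at x)"
    if "x \<in> S" for x
    using frechet_derivative_cong_on[OF assms(1) that Suc.prems(1)] Suc.prems(2) that by simp_all
  have "Ck_on k S (\<lambda>x. frechet_derivative g (at x) v)" for v
  proof (rule Suc.IH)
    show "Ck_on k S (\<lambda>x. frechet_derivative f (at x) v)" using Suc.prems(2) by simp
  qed (simp add: fg(2))
  then show ?case by (simp add: fg(1))
qed

text \<open>Derivatives at a point are unique, so \<open>frechet_derivative\<close>, which is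
  defined by choice, may be replaced on the open set by any explicit formula.\<close>

lemma Ck_on_SucI:
  assumes "open S" "\<And>x. x \<in> S \<Longrightarrow> (f has_derivative f' x) (at x)"
    and "\<And>v. Ck_on k S (\<lambda>x. f' x v)"
  shows "Ck_on (Suc k) S f"
proof -
  have "Ck_on k S (\<lambda>x. frechet_derivative f (at x) v)" for v
    by (rule Ck_on_cong[OF assms(1) _ assms(3)[of v]])
      (use assms(2) frechet_derivative_at in metis)
  then show ?thesis
    using assms(2) by (auto intro: differentiableI)
qed

lemma Ck_on_SucD:
  assumes "Ck_on (Suc k) S f"
  shows "\<And>x. x \<in> S \<Longrightarrow> (f has_derivative frechet_derivative f (at x)) (at x)"
    and "\<And>v. Ck_on k S (\<lambda>x. frechet_derivative f (at x) v)"
  using assms by (auto simp: frechet_derivative_works)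

lemma Ck_on_Suc_imp: "Ck_on (Suc k) S f \<Longrightarrow> Ck_on k S f"
proof (induction k arbitrary: f)
  case 0
  then show ?case
    by (auto intro: continuous_at_imp_continuous_on differentiable_imp_continuous_within)
next
  case (Suc k)
  show ?case
    unfolding Ck_on.simps(2)[of k]
  proof (intro conjI allI)
    show "\<forall>x\<in>S. f differentiable (at x)" using Suc.prems by simp
    show "Ck_on k S (\<lambda>x. frechet_derivative f (at x) v)" for v
      using Suc.IH[of "\<lambda>x. frechet_derivative f (at x) v"] Ck_on_SucD(2)[OF Suc.prems] by blast
  qed
qed

lemma Ck_on_subset: "Ck_on k S f \<Longrightarrow> T \<subseteq> S \<Longrightarrow> Ck_on k T f"
  by (induction k arbitrary: f) (auto intro: continuous_on_subset)

text \<open>Continuity and differentiability at \<open>x\<close> only see a neighbourhood of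
  \<open>x\<close>, and an open \<open>T\<close> turns continuity on \<open>T\<close> into
  continuity at \<open>x\<close>. This serves to glue along open covers.\<close>

lemma Ck_on_local:
  assumes "\<And>x. x \<in> S \<Longrightarrow> \<exists>T. open T \<and> x \<in> T \<and> Ck_on k T f"
  shows "Ck_on k S f"
  using assms
proof (induction k arbitrary: f)
  case 0
  then show ?case
    by (metis Ck_on.simps(1) continuous_at_imp_continuous_on continuous_on_eq_continuous_at)
next
  case (Suc k)
  have "Ck_on k S (\<lambda>x. frechet_derivative f (at x) v)" for v
    by (rule Suc.IH) (metis Suc.prems Ck_on.simps(2))
  then show ?case using Suc.prems by (metis Ck_on.simps(2))
qed

lemma Ck_on_const: "Ck_on k S (\<lambda>x. c)"
  by (induction k arbitrary: c) auto

lemma Ck_on_bounded_linear: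
  assumes "open S" "bounded_linear L" "Ck_on k S f"
  shows "Ck_on k S (\<lambda>x. L (f x))"
  using assms(3)
proof (induction k arbitrary: f)
  case 0
  then show ?case
    by (auto intro: bounded_linear.continuous_on[OF assms(2)])
next
  case (Suc k)
  show ?case
    by (rule Ck_on_SucI[OF assms(1)
          bounded_linear.has_derivative[OF assms(2) Ck_on_SucD(1)[OF Suc.prems]]
          Suc.IH[OF Ck_on_SucD(2)[OF Suc.prems]]])
qed

lemma Ck_on_id: "open S \<Longrightarrow> Ck_on k S (\<lambda>x. x)"
proof (cases k)
  case (Suc n)
  assume "open S"
  then show ?thesis
    unfolding Suc by (intro Ck_on_SucI[where f'="\<lambda>x v. v"] has_derivative_ident Ck_on_const)
qed auto

lemma Ck_on_add:
  assumes "open S" "Ck_on k S f" "Ck_on k S g"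
  shows "Ck_on k S (\<lambda>x. f x + g x)"
  using assms(2,3)
proof (induction k arbitrary: f g)
  case 0
  then show ?case by (auto intro: continuous_on_add)
next
  case (Suc k)
  show ?case
    by (rule Ck_on_SucI[OF assms(1) has_derivative_add[OF Ck_on_SucD(1)[OF Suc.prems(1)]
            Ck_on_SucD(1)[OF Suc.prems(2)]]
          Suc.IH[OF Ck_on_SucD(2)[OF Suc.prems(1)] Ck_on_SucD(2)[OF Suc.prems(2)]]])
qed

lemma Ck_on_sum:
  assumes "open S" "\<And>i. i \<in> I \<Longrightarrow> Ck_on k S (f i)"
  shows "Ck_on k S (\<lambda>x. \<Sum>i\<in>I. f i x)"
  using assms(2) by (induction I rule: infinite_finite_induct) (auto intro: Ck_on_const Ck_on_add[OF assms(1)])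

lemma Ck_on_scaleR:
  fixes f :: "_ \<Rightarrow> real"
  assumes "open S" "Ck_on k S f" "Ck_on k S g"
  shows "Ck_on k S (\<lambda>x. f x *\<^sub>R g x)"
  using assms(2,3)
proof (induction k arbitrary: f g)
  case 0
  then show ?case by (auto intro: continuous_on_scaleR)
next
  case (Suc k)
  show ?case
    by (rule Ck_on_SucI[OF assms(1) has_derivative_scaleR[OF Ck_on_SucD(1)[OF Suc.prems(1)]
            Ck_on_SucD(1)[OF Suc.prems(2)]]])
      (auto intro!: Ck_on_add[OF assms(1)] Suc.IH Ck_on_Suc_imp[OF Suc.prems(1)] Ck_on_Suc_imp[OF Suc.prems(2)]
        Ck_on_SucD(2)[OF Suc.prems(1)] Ck_on_SucD(2)[OF Suc.prems(2)])
qed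

lemma Ck_on_compose:
  fixes f :: "'b::euclidean_space \<Rightarrow> 'c::real_normed_vector"
  assumes "open S" "Ck_on k T f" "Ck_on k S g" "g ` S \<subseteq> T"
  shows "Ck_on k S (\<lambda>x. f (g x))"
  using assms(2,3)
proof (induction k arbitrary: f)
  case 0
  then show ?case using continuous_on_compose2[OF _ _ assms(4)] by simp
next
  case (Suc k)
  have chain: "((\<lambda>x. f (g x)) has_derivative
      (\<lambda>v. frechet_derivative f (at (g x)) (frechet_derivative g (at x) v))) (at x)" if "x \<in> S" for x
    using has_derivative_compose[OF Ck_on_SucD(1)[OF Suc.prems(2) that] Ck_on_SucD(1)[OF Suc.prems(1), of "g x"]]
      assms(4) that by auto
  \<comment> \<open>\<open>Ck_on\<close> controls derivatives in a fixed direction, whereas the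
    chain rule inserts the direction \<open>frechet_derivative g (at x) v\<close>, which varies with
    \<open>x\<close>. Expanding it in the basis leaves fixed directions with coefficients of class
    Ck.\<close>
  have expand: "frechet_derivative f (at (g x)) w
      = (\<Sum>b\<in>Basis. (w \<bullet> b) *\<^sub>R frechet_derivative f (at (g x)) b)" if "x \<in> S" for x w
  proof -
    have "linear (frechet_derivative f (at (g x)))"
      using Ck_on_SucD(1)[OF Suc.prems(1), of "g x"] assms(4) that
      by (auto intro: has_derivative_linear)
    then have "frechet_derivative f (at (g x)) (\<Sum>b\<in>Basis. (w \<bullet> b) *\<^sub>R b)
      = (\<Sum>b\<in>Basis. (w \<bullet> b) *\<^sub>R frechet_derivative f (at (g x)) b)"
      by (simp only: linear_sum linear_cmul)
    then show ?thesis by (simp only: euclidean_representation)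
  qed
  show ?case
  proof (rule Ck_on_SucI[OF assms(1)])
    show "((\<lambda>x. f (g x)) has_derivative (\<lambda>v. \<Sum>b\<in>Basis. (frechet_derivative g (at x) v \<bullet> b) *\<^sub>R
        frechet_derivative f (at (g x)) b)) (at x)" if "x \<in> S" for x
      by (rule has_derivative_eq_rhs[OF chain[OF that]]) (rule ext, rule expand[OF that])
    show "Ck_on k S (\<lambda>x. \<Sum>b\<in>Basis. (frechet_derivative g (at x) v \<bullet> b) *\<^sub>R
        frechet_derivative f (at (g x)) b)" for v
      by (intro Ck_on_sum[OF assms(1)] Ck_on_scaleR[OF assms(1)]
          Suc.IH[OF Ck_on_SucD(2)[OF Suc.prems(1)] Ck_on_Suc_imp[OF Suc.prems(2)]]
          Ck_on_bounded_linear[OF assms(1) bounded_linear_inner_left Ck_on_SucD(2)[OF Suc.prems(2)]])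
  qed
qed

section \<open>Smooth maps: the closure properties for all orders at once\<close>

lemma smooth_on_cong:
  "open S \<Longrightarrow> (\<And>x. x \<in> S \<Longrightarrow> f x = g x) \<Longrightarrow> smooth_on S f \<Longrightarrow> smooth_on S g"
  unfolding smooth_on_def using Ck_on_cong by blast

lemma smooth_on_subset: "smooth_on S f \<Longrightarrow> T \<subseteq> S \<Longrightarrow> smooth_on T f"
  unfolding smooth_on_def using Ck_on_subset by blast

lemma smooth_on_Un:
  assumes "open S" "open T" "smooth_on S f" "smooth_on T f"
  shows "smooth_on (S \<union> T) f"
  unfolding smooth_on_def
proof (intro allI Ck_on_local)
  fix k x assume "x \<in> S \<union> T"
  then show "\<exists>U. open U \<and> x \<in> U \<and> Ck_on k U f"
    using assms unfolding smooth_on_def by (metis Un_iff)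
qed

lemma smooth_on_const: "smooth_on S (\<lambda>x. c)"
  by (simp add: smooth_on_def Ck_on_const)

lemma smooth_on_id: "open S \<Longrightarrow> smooth_on S (\<lambda>x. x)"
  by (simp add: smooth_on_def Ck_on_id)

lemma smooth_on_bounded_linear:
  "open S \<Longrightarrow> bounded_linear L \<Longrightarrow> smooth_on S f \<Longrightarrow> smooth_on S (\<lambda>x. L (f x))"
  by (simp add: smooth_on_def Ck_on_bounded_linear)

lemma smooth_on_add:
  "open S \<Longrightarrow> smooth_on S f \<Longrightarrow> smooth_on S g \<Longrightarrow> smooth_on S (\<lambda>x. f x + g x)"
  by (simp add: smooth_on_def Ck_on_add)

lemma smooth_on_sum:
  "open S \<Longrightarrow> (\<And>i. i \<in> I \<Longrightarrow> smooth_on S (f i)) \<Longrightarrow> smooth_on S (\<lambda>x. \<Sum>i\<in>I. f i x)"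
  by (simp add: smooth_on_def Ck_on_sum)

lemma smooth_on_mult:
  fixes f g :: "_ \<Rightarrow> real"
  shows "open S \<Longrightarrow> smooth_on S f \<Longrightarrow> smooth_on S g \<Longrightarrow> smooth_on S (\<lambda>x. f x * g x)"
  using Ck_on_scaleR[of S _ f g] by (auto simp: smooth_on_def)

lemma smooth_on_compose:
  "open S \<Longrightarrow> smooth_on T f \<Longrightarrow> smooth_on S g \<Longrightarrow> g ` S \<subseteq> T \<Longrightarrow> smooth_on S (\<lambda>x. f (g x))"
  unfolding smooth_on_def using Ck_on_compose by blast

lemma smooth_on_has_derivative:
  "smooth_on S f \<Longrightarrow> x \<in> S \<Longrightarrow> (f has_derivative frechet_derivative f (at x)) (at x)"
  unfolding smooth_on_def using Ck_on_SucD(1) by blast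

lemma smooth_on_frechet_derivative:
  "smooth_on S f \<Longrightarrow> smooth_on S (\<lambda>x. frechet_derivative f (at x) v)"
  unfolding smooth_on_def using Ck_on_SucD(2) by blast

section \<open>Bump functions\<close>

definition poly_exp_inverse :: "real poly \<Rightarrow> real \<Rightarrow> real"
  where "poly_exp_inverse p x = (if x > 0 then poly p (1 / x) * exp (- (1 / x)) else 0)"

lemma poly_times_exp_minus_tendsto_0: "((\<lambda>u. poly p u * exp (- u)) \<longlongrightarrow> 0) at_top" for p :: "real poly"
proof -
  have "((\<lambda>u. \<Sum>i\<le>degree p. coeff p i * (u ^ i / exp u)) \<longlongrightarrow> (\<Sum>i\<le>degree p. coeff p i * 0)) at_top"
    by (intro tendsto_sum tendsto_mult tendsto_const tendsto_power_div_exp_0)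
  then show ?thesis
    by (simp add: poly_altdef sum_divide_distrib exp_minus divide_inverse sum_distrib_right mult.assoc)
qed

text \<open>Each derivative is again a polynomial in \<open>1/x\<close> times \<open>exp (-1/x)\<close>, so the induction stays inside
  this family.\<close>

lemma has_derivative_poly_exp_inverse:
  "(poly_exp_inverse p has_real_derivative poly_exp_inverse (pCons 0 (pCons 0 (p - pderiv p))) x) (at x)"
proof -
  consider "x > 0" | "x < 0" | "x = 0" by linarith
  then show ?thesis
  proof cases
    case 1
    \<comment> \<open>With u = 1/x, the derivative of p(u) exp(-u) is u^2 (p(u) - p'(u)) exp(-u);
      the factor u^2 is the double \<open>pCons 0\<close>.\<close>
    have "((\<lambda>x. poly p (1 / x) * exp (- (1 / x))) has_real_derivative
        poly_exp_inverse (pCons 0 (pCons 0 (p - pderiv p))) x) (at x)"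
      using 1 by (auto intro!: derivative_eq_intros DERIV_chain2[OF poly_DERIV]
          simp: poly_exp_inverse_def field_simps)
    then show ?thesis
      by (rule has_field_derivative_transform_within_open[where S="{0<..}"])
        (use 1 in \<open>auto simp: poly_exp_inverse_def\<close>)
  next
    case 2
    have "((\<lambda>x. 0) has_real_derivative poly_exp_inverse (pCons 0 (pCons 0 (p - pderiv p))) x) (at x)"
      using 2 by (auto simp: poly_exp_inverse_def)
    then show ?thesis
      by (rule has_field_derivative_transform_within_open[where S="{..<0}"])
        (use 2 in \<open>auto simp: poly_exp_inverse_def\<close>)
  next
    case 3
    \<comment> \<open>The difference quotient at 0 from the right is u p(u) exp(-u) with u = 1/h,
      again a member of the family.\<close>
    have "((\<lambda>h. poly (pCons 0 p) (inverse h) * exp (- inverse h)) \<longlongrightarrow> 0) (at_right 0)"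
      by (rule filterlim_compose[OF poly_times_exp_minus_tendsto_0 filterlim_inverse_at_top_right])
    then have "((\<lambda>h. poly_exp_inverse p h / h) \<longlongrightarrow> 0) (at_right 0)"
      by (rule Lim_transform_eventually)
        (auto simp: poly_exp_inverse_def eventually_at_right_less field_simps
          intro!: eventually_mono[OF eventually_at_right_less])
    moreover have "((\<lambda>h. poly_exp_inverse p h / h) \<longlongrightarrow> 0) (at_left 0)"
      by (rule Lim_transform_eventually[OF tendsto_const])
        (auto simp: poly_exp_inverse_def eventually_at_left_field intro!: exI[of _ "-1"])
    ultimately have "((\<lambda>h. poly_exp_inverse p h / h) \<longlongrightarrow> 0) (at 0)"
      by (simp add: filterlim_split_at)
    then show ?thesis
      using 3 by (simp add: DERIV_def poly_exp_inverse_def)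
  qed
qed

lemma smooth_on_poly_exp_inverse: "smooth_on UNIV (poly_exp_inverse p)"
proof -
  have "Ck_on k UNIV (poly_exp_inverse p)" for k
  proof (induction k arbitrary: p)
    case 0
    show ?case
      using has_derivative_poly_exp_inverse
      by (auto intro!: continuous_at_imp_continuous_on DERIV_isCont)
  next
    case (Suc k)
    show ?case
    proof (rule Ck_on_SucI)
      show "(poly_exp_inverse p has_derivative
          (\<lambda>v. poly_exp_inverse (pCons 0 (pCons 0 (p - pderiv p))) x * v)) (at x)" for x
        using has_derivative_poly_exp_inverse has_field_derivative_def by blast
      show "Ck_on k UNIV (\<lambda>x. poly_exp_inverse (pCons 0 (pCons 0 (p - pderiv p))) x * v)" for v
        by (rule Ck_on_bounded_linear[OF open_UNIV bounded_linear_mult_left Suc.IH])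
    qed simp
  qed
  then show ?thesis by (simp add: smooth_on_def)
qed

lemma smooth_bump:
  fixes c :: "'e::euclidean_space"
  assumes "r > 0"
  obtains \<rho> where "smooth_on UNIV \<rho>" "\<rho> c \<noteq> (0::real)" "\<And>x. x \<notin> cball c r \<Longrightarrow> \<rho> x = 0"
proof
  \<comment> \<open>This is exp(-1/t) at t = r^2 - |x - c|^2. The squared distance is written in
    coordinates so that smoothness follows from sums and products of linear maps.\<close>
  let ?\<rho> = "\<lambda>x. poly_exp_inverse 1 (r\<^sup>2 + (\<Sum>i\<in>Basis. (- ((x - c) \<bullet> i)) * ((x - c) \<bullet> i)))"
  have *: "smooth_on UNIV (\<lambda>x. (x - c) \<bullet> i)" for i
    using smooth_on_add[OF open_UNIV smooth_on_bounded_linear[OF open_UNIV bounded_linear_inner_left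
          smooth_on_id[OF open_UNIV]] smooth_on_const[of UNIV "- (c \<bullet> i)"], of i]
    by (simp add: inner_diff_left)
  show "smooth_on UNIV ?\<rho>"
    by (intro smooth_on_compose[OF open_UNIV smooth_on_poly_exp_inverse] smooth_on_add[OF open_UNIV]
        smooth_on_const smooth_on_sum[OF open_UNIV] smooth_on_mult[OF open_UNIV] *
        smooth_on_bounded_linear[OF open_UNIV bounded_linear_minus[OF bounded_linear_ident]]) auto
  show "?\<rho> c \<noteq> 0"
    using assms by (simp add: poly_exp_inverse_def)
  have sq: "(\<Sum>i\<in>Basis. (- ((x - c) \<bullet> i)) * ((x - c) \<bullet> i)) = - (dist c x)\<^sup>2" for x
  proof -
    have "(dist c x)\<^sup>2 = (x - c) \<bullet> (x - c)"
      by (subst dist_commute) (simp only: dist_norm power2_norm_eq_inner)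
    then show ?thesis by (simp add: sum_negf euclidean_inner[of "x - c" "x - c"])
  qed
  show "?\<rho> x = 0" if "x \<notin> cball c r" for x
    using that power_strict_mono[of r "dist c x" 2] assms unfolding sq
    by (simp add: poly_exp_inverse_def not_le)
qed

section \<open>Hadamard's lemma\<close>

text \<open>Differentiation under the integral sign replaces \<open>f\<close> by a directional
  derivative and produces one more factor \<open>t\<close>. The free exponent \<open>m\<close> keeps
  the induction on \<open>k\<close> inside this class of integrals.\<close>

lemma Ck_on_ray_average:
  fixes f :: "'e::euclidean_space \<Rightarrow> real"
  assumes "open S" "convex S" "a \<in> S" "smooth_on S f"
  shows "Ck_on k S (\<lambda>x. integral {0..1} (\<lambda>t. t ^ m * f (a + t *\<^sub>R (x - a))))"
  using assms(4)
proof (induction k arbitrary: m f)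
  have ray: "a + t *\<^sub>R (x - a) \<in> S" if "x \<in> S" "t \<in> {0..1}" for x t
    using convexD_alt[OF assms(2,3) that(1), of t] that(2) by (simp add: algebra_simps)
  have cont: "continuous_on (S \<times> {0..1}) (\<lambda>(x, t). t ^ m * f (a + t *\<^sub>R (x - a)))"
    if "smooth_on S f" for m and f :: "'e \<Rightarrow> real"
  proof -
    have "continuous_on S f" using that by (metis Ck_on.simps(1) smooth_on_def)
    then have "continuous_on (S \<times> {0..1}) (\<lambda>z. f (a + snd z *\<^sub>R (fst z - a)))"
      by (rule continuous_on_compose2) (auto intro!: continuous_intros ray)
    then show ?thesis
      by (auto simp: case_prod_unfold intro!: continuous_intros)
  qed
  {
    case 0
    show ?case
      using integral_continuous_on_param[of S 0 1 "\<lambda>x t. t ^ m * f (a + t *\<^sub>R (x - a))"] cont[OF 0]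
      by simp
  next
    case (Suc k)
    note sm = Suc.prems
    let ?D = "\<lambda>y v. frechet_derivative f (at y) v"
    have cont1: "continuous_on {0..1} (\<lambda>t. t ^ m * f (a + t *\<^sub>R (x - a)))"
      if "smooth_on S f" "x \<in> S" for m x and f :: "'e \<Rightarrow> real"
    proof -
      have "continuous_on {0..1} (\<lambda>t. (\<lambda>(y, t). t ^ m * f (a + t *\<^sub>R (y - a))) (x, t))"
        by (rule continuous_on_compose2[OF cont[OF that(1)]])
          (use that(2) in \<open>auto intro!: continuous_intros\<close>)
      then show ?thesis by simp
    qed
    show ?case
    proof (rule Ck_on_SucI[OF assms(1)])
      fix x assume x: "x \<in> S"
      \<comment> \<open>\<open>leibniz_rule\<close> asks for derivatives in the type of bounded
        linear maps, depending continuously on both variables; in finite dimension this continuity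
        can be checked on basis vectors.\<close>
      define G where "G y t = Blinfun (\<lambda>v. t ^ Suc m * ?D (a + t *\<^sub>R (y - a)) v)" for y t
      have bl: "bounded_linear (\<lambda>v. t ^ Suc m * ?D (a + t *\<^sub>R (y - a)) v)"
        if "y \<in> S" "t \<in> {0..1}" for y t
        using smooth_on_has_derivative[OF sm ray[OF that]]
        by (intro bounded_linear_mult_const bounded_linear_const_mult)
           (auto dest: has_derivative_bounded_linear)
      have G: "blinfun_apply (G y t) = (\<lambda>v. t ^ Suc m * ?D (a + t *\<^sub>R (y - a)) v)"
        if "y \<in> S" "t \<in> {0..1}" for y t
        unfolding G_def using bl[OF that] by (simp add: bounded_linear_Blinfun_apply)
      have contG: "continuous_on (S \<times> cbox 0 1) (\<lambda>(y, t). G y t)"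
        unfolding cbox_interval
      proof (rule continuous_on_blinfun_componentwise)
        fix i :: 'e assume "i \<in> Basis"
        show "continuous_on (S \<times> {0..1}) (\<lambda>z. blinfun_apply (case z of (y, t) \<Rightarrow> G y t) i)"
          by (rule continuous_on_eq[OF cont[OF smooth_on_frechet_derivative[OF sm, of i], of "Suc m"]])
            (auto simp: G)
      qed
      have deriv: "((\<lambda>x. integral (cbox 0 1) (\<lambda>t. t ^ m * f (a + t *\<^sub>R (x - a)))) has_derivative
          blinfun_apply (integral (cbox 0 1) (G x))) (at x within S)"
      proof (rule leibniz_rule[OF _ _ contG x assms(2)])
        fix y and t :: real assume y: "y \<in> S" "t \<in> cbox 0 1"
        have d: "(f has_derivative ?D (a + t *\<^sub>R (y - a))) (at (a + t *\<^sub>R (y - a)))"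
          using smooth_on_has_derivative[OF sm ray] y by simp
        have "((\<lambda>x. t ^ m * f (a + t *\<^sub>R (x - a))) has_derivative
           (\<lambda>v. t ^ m * ?D (a + t *\<^sub>R (y - a)) (t *\<^sub>R v))) (at y)"
          by (intro has_derivative_mult_right
              has_derivative_compose[where f="\<lambda>x. a + t *\<^sub>R (x - a)", OF _ d])
            (auto intro!: derivative_eq_intros)
        moreover have "?D (a + t *\<^sub>R (y - a)) (t *\<^sub>R v) = t * ?D (a + t *\<^sub>R (y - a)) v" for v
          using linear_cmul[OF has_derivative_linear[OF d]] by simp
        ultimately show "((\<lambda>x. t ^ m * f (a + t *\<^sub>R (x - a))) has_derivative
           blinfun_apply (G y t)) (at y within S)"
          using G y by (auto simp: mult_ac intro: has_derivative_at_withinI)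
      next
        show "(\<lambda>t. t ^ m * f (a + t *\<^sub>R (y - a))) integrable_on cbox 0 1" if "y \<in> S" for y
          using cont1[OF sm that] by (auto intro: integrable_continuous_interval)
      qed
      have value_at: "blinfun_apply (integral (cbox 0 1) (G x)) v
          = integral {0..1} (\<lambda>t. t ^ Suc m * ?D (a + t *\<^sub>R (x - a)) v)" for v
      proof -
        have "continuous_on (cbox 0 1) (\<lambda>t. (\<lambda>(y, t). G y t) (x, t))"
          by (rule continuous_on_compose2[OF contG]) (use x in \<open>auto intro!: continuous_intros\<close>)
        then have "continuous_on (cbox 0 1) (G x)" by simp
        then have "G x integrable_on cbox 0 1" by (rule integrable_continuous)
        then have "blinfun_apply (integral (cbox 0 1) (G x)) v
            = integral (cbox 0 1) (\<lambda>t. blinfun_apply (G x t) v)"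
          by (rule blinfun_apply_integral)
        also have "\<dots> = integral (cbox 0 1) (\<lambda>t. t ^ Suc m * ?D (a + t *\<^sub>R (x - a)) v)"
          by (rule integral_cong) (use G x in auto)
        finally show ?thesis by simp
      qed
      show "((\<lambda>x. integral {0..1} (\<lambda>t. t ^ m * f (a + t *\<^sub>R (x - a)))) has_derivative
          (\<lambda>v. integral {0..1} (\<lambda>t. t ^ Suc m * ?D (a + t *\<^sub>R (x - a)) v))) (at x)"
        using has_derivative_eq_rhs[OF deriv ext[OF value_at]]
        unfolding at_within_open[OF x assms(1)] cbox_interval .
    next
      show "Ck_on k S (\<lambda>x. integral {0..1} (\<lambda>t. t ^ Suc m * ?D (a + t *\<^sub>R (x - a)) v))" for v
        by (rule Suc.IH[OF smooth_on_frechet_derivative[OF sm]])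
    qed
  }
qed

text \<open>By the fundamental theorem of calculus, \<open>f x - f a\<close> is the integral of the
  derivative along the segment from \<open>a\<close> to \<open>x\<close>, and \<open>g i\<close>
  averages the i-th partial derivative over that segment. Applying a derivation at \<open>a\<close>
  to the expansion then only sees the values \<open>g i a\<close>.\<close>

lemma hadamard:
  fixes f :: "'e::euclidean_space \<Rightarrow> real"
  assumes "open S" "convex S" "a \<in> S" "smooth_on S f"
  obtains g where "\<And>i. smooth_on S (g i)" "\<And>i. g i a = frechet_derivative f (at a) i"
    "\<And>x. x \<in> S \<Longrightarrow> f x = f a + (\<Sum>i\<in>Basis. ((x - a) \<bullet> i) * g i x)"
proof
  \<comment> \<open>The factor \<open>t ^ 0\<close> is kept to match
    \<open>Ck_on_ray_average\<close> with \<open>m = 0\<close>.\<close>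
  let ?g = "\<lambda>i x. integral {0..1} (\<lambda>t. t ^ 0 * frechet_derivative f (at (a + t *\<^sub>R (x - a))) i)"
  show "smooth_on S (?g i)" for i
    unfolding smooth_on_def
    using Ck_on_ray_average[OF assms(1-3) smooth_on_frechet_derivative[OF assms(4)]] by blast
  show "?g i a = frechet_derivative f (at a) i" for i by simp
  fix x assume x: "x \<in> S"
  have ray: "a + t *\<^sub>R (x - a) \<in> S" if "t \<in> {0..1}" for t
    using convexD_alt[OF assms(2,3) x, of t] that by (simp add: algebra_simps)
  have ftc: "((\<lambda>t. frechet_derivative f (at (a + t *\<^sub>R (x - a))) (x - a)) has_integral
      f (a + 1 *\<^sub>R (x - a)) - f (a + 0 *\<^sub>R (x - a))) {0..1}"
  proof (rule fundamental_theorem_of_calculus)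
    fix t :: real assume t: "t \<in> {0..1}"
    have d: "(f has_derivative frechet_derivative f (at (a + t *\<^sub>R (x - a)))) (at (a + t *\<^sub>R (x - a)))"
      using smooth_on_has_derivative[OF assms(4) ray[OF t]] .
    have "((\<lambda>t. f (a + t *\<^sub>R (x - a))) has_derivative
       (\<lambda>s. frechet_derivative f (at (a + t *\<^sub>R (x - a))) (s *\<^sub>R (x - a)))) (at t within {0..1})"
      by (rule has_derivative_compose[where f="\<lambda>t. a + t *\<^sub>R (x - a)", OF _ d])
        (auto intro!: derivative_eq_intros)
    then show "((\<lambda>t. f (a + t *\<^sub>R (x - a))) has_vector_derivative
       frechet_derivative f (at (a + t *\<^sub>R (x - a))) (x - a)) (at t within {0..1})"
      unfolding has_vector_derivative_def
      using linear_cmul[OF has_derivative_linear[OF d]] by simp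
  qed simp
  have components: "frechet_derivative f (at (a + t *\<^sub>R (x - a))) (x - a)
      = (\<Sum>i\<in>Basis. ((x - a) \<bullet> i) * frechet_derivative f (at (a + t *\<^sub>R (x - a))) i)"
    if "t \<in> {0..1}" for t
  proof -
    have "linear (frechet_derivative f (at (a + t *\<^sub>R (x - a))))"
      using smooth_on_has_derivative[OF assms(4) ray[OF that]] by (rule has_derivative_linear)
    then have "frechet_derivative f (at (a + t *\<^sub>R (x - a))) (\<Sum>i\<in>Basis. ((x - a) \<bullet> i) *\<^sub>R i)
      = (\<Sum>i\<in>Basis. ((x - a) \<bullet> i) *\<^sub>R frechet_derivative f (at (a + t *\<^sub>R (x - a))) i)"
      by (simp only: linear_sum linear_cmul)
    then show ?thesis by (simp add: euclidean_representation)
  qed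
  have 1: "((\<lambda>t. \<Sum>i\<in>Basis. ((x - a) \<bullet> i) * frechet_derivative f (at (a + t *\<^sub>R (x - a))) i)
      has_integral f x - f a) {0..1}"
    using has_integral_eq[OF components ftc] by simp
  have "((\<lambda>t. \<Sum>i\<in>Basis. ((x - a) \<bullet> i) * frechet_derivative f (at (a + t *\<^sub>R (x - a))) i)
      has_integral (\<Sum>i\<in>Basis. ((x - a) \<bullet> i) * ?g i x)) {0..1}"
  proof (intro has_integral_sum has_integral_mult_right)
    fix i :: 'e
    have "continuous_on S (\<lambda>y. frechet_derivative f (at y) i)"
      using smooth_on_frechet_derivative[OF assms(4)] by (metis Ck_on.simps(1) smooth_on_def)
    then have "continuous_on {0..1} (\<lambda>t. frechet_derivative f (at (a + t *\<^sub>R (x - a))) i)"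
      by (rule continuous_on_compose2) (auto intro!: continuous_intros ray)
    then show "((\<lambda>t. frechet_derivative f (at (a + t *\<^sub>R (x - a))) i) has_integral ?g i x) {0..1}"
      by (simp add: integrable_continuous_interval integrable_integral)
  qed simp
  from has_integral_unique[OF 1 this] show "f x = f a + (\<Sum>i\<in>Basis. ((x - a) \<bullet> i) * ?g i x)"
    by linarith
qed

section \<open>Smooth functions and vector fields on a manifold\<close>

lemma sum_fun_apply: "(\<Sum>i\<in>I. F i) x = (\<Sum>i\<in>I. F i x)"
  by (induction I rule: infinite_finite_induct) (auto simp: zero_fun_def)

locale smooth_atlas =
  fixes A :: "('m::{t2_space, second_countable_topology}, 'e::euclidean_space) atlas"
  assumes smooth_manifold: "smooth_manifold A"
begin

abbreviation "SF \<equiv> smooth_functions A"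
abbreviation "TM \<equiv> tangent_space A"
abbreviation "VF \<equiv> vector_fields A"

lemma chart:
  assumes "(U, \<phi>) \<in> A"
  shows "open U" "open (\<phi> ` U)" "continuous_on U \<phi>" "continuous_on (\<phi> ` U) (inv_into U \<phi>)" "inj_on \<phi> U"
proof -
  have *: "is_chart (U, \<phi>)" using smooth_manifold assms unfolding smooth_manifold_def by blast
  then show "open U" "open (\<phi> ` U)" "continuous_on U \<phi>" "continuous_on (\<phi> ` U) (inv_into U \<phi>)"
    by (auto simp: is_chart_def homeomorphism_def)
  from * have "\<forall>x\<in>U. inv_into U \<phi> (\<phi> x) = x" by (simp add: is_chart_def homeomorphism_def)
  then show "inj_on \<phi> U" by (metis inj_on_inverseI)
qed

lemma chart_around: obtains U \<phi> where "(U, \<phi>) \<in> A" "p \<in> U"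
proof -
  have "p \<in> (\<Union>(U, \<phi>)\<in>A. U)" using smooth_manifold by (simp add: smooth_manifold_def)
  then show thesis using that by blast
qed

lemma open_chart_image:
  assumes "(U, \<phi>) \<in> A" "open O'" "O' \<subseteq> U"
  shows "open (\<phi> ` O')"
proof -
  have "\<phi> ` O' = \<phi> ` U \<inter> inv_into U \<phi> -` O'"
    using assms(3) chart(5)[OF assms(1)] by auto
  then show ?thesis
    using continuous_open_preimage[OF chart(4,2)[OF assms(1)] assms(2)] by simp
qed

lemma smooth_transition:
  assumes "(U, \<phi>) \<in> A" "(V, \<psi>) \<in> A"
  shows "smooth_on (\<phi> ` (U \<inter> V)) (\<psi> \<circ> inv_into U \<phi>)"
  using smooth_manifold assms unfolding smooth_manifold_def by blast

lemma SF_iff: "f \<in> SF \<longleftrightarrow> (\<forall>(U, \<phi>)\<in>A. smooth_on (\<phi> ` U) (\<lambda>x. f (inv_into U \<phi> x)))"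
  by (simp add: smooth_functions_def o_def)

lemma SF_const: "(\<lambda>p. c) \<in> SF"
  by (auto simp: SF_iff smooth_on_const)

lemma SF_add: "f \<in> SF \<Longrightarrow> g \<in> SF \<Longrightarrow> (\<lambda>p. f p + g p) \<in> SF"
  unfolding SF_iff using smooth_on_add chart(2) by fast

lemma SF_mult: "f \<in> SF \<Longrightarrow> g \<in> SF \<Longrightarrow> (\<lambda>p. f p * g p) \<in> SF"
  unfolding SF_iff using smooth_on_mult chart(2) by fast

lemma SF_cmult: "f \<in> SF \<Longrightarrow> (\<lambda>p. c * f p) \<in> SF"
  using SF_mult[OF SF_const] .

lemma SF_uminus: "f \<in> SF \<Longrightarrow> (\<lambda>p. - f p) \<in> SF"
  using SF_cmult[of f "-1"] by simp

lemma SF_diff: "f \<in> SF \<Longrightarrow> g \<in> SF \<Longrightarrow> (\<lambda>p. f p - g p) \<in> SF"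
  using SF_add[OF _ SF_uminus] by simp

lemma SF_sum: "(\<And>i. i \<in> I \<Longrightarrow> f i \<in> SF) \<Longrightarrow> (\<lambda>p. \<Sum>i\<in>I. f i p) \<in> SF"
  by (induction I rule: infinite_finite_induct) (auto intro: SF_const SF_add)

lemma TM_add:
  "v \<in> TM p \<Longrightarrow> f \<in> SF \<Longrightarrow> g \<in> SF \<Longrightarrow> v (\<lambda>q. f q + g q) = v f + v g"
  by (simp add: tangent_space_def plus_fun_def)

lemma TM_mult:
  "v \<in> TM p \<Longrightarrow> f \<in> SF \<Longrightarrow> g \<in> SF \<Longrightarrow> v (\<lambda>q. f q * g q) = v f * g p + f p * v g"
  by (simp add: tangent_space_def times_fun_def)

lemma TM_cmult: "v \<in> TM p \<Longrightarrow> f \<in> SF \<Longrightarrow> v (\<lambda>q. c * f q) = c * v f"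
  by (simp add: tangent_space_def scaleR_fun_def)

lemma TM_const: assumes "v \<in> TM p" shows "v (\<lambda>q. c) = 0"
proof -
  have "v (\<lambda>q. 1) = 0"
    using TM_mult[OF assms SF_const SF_const, of 1 1] by simp
  then show ?thesis using TM_cmult[OF assms SF_const, of c 1] by simp
qed

lemma TM_diff: "v \<in> TM p \<Longrightarrow> f \<in> SF \<Longrightarrow> g \<in> SF \<Longrightarrow> v (\<lambda>q. f q - g q) = v f - v g"
  using TM_add[of v p f "\<lambda>q. - g q"] TM_cmult[of v p g "-1"] SF_uminus by simp

lemma TM_sum:
  assumes "v \<in> TM p" "\<And>i. i \<in> I \<Longrightarrow> f i \<in> SF"
  shows "v (\<lambda>q. \<Sum>i\<in>I. f i q) = (\<Sum>i\<in>I. v (f i))"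
  using assms(2)
  by (induction I rule: infinite_finite_induct)
     (auto simp: TM_const[OF assms(1)] TM_add[OF assms(1)] SF_sum)

lemma TM_not_smooth: "v \<in> TM p \<Longrightarrow> f \<notin> SF \<Longrightarrow> v f = 0"
  by (simp add: tangent_space_def)

lemma subspace_TM: "subspace (TM p)"
  unfolding subspace_def tangent_space_def
  by (auto simp: scaleR_fun_def zero_fun_def plus_fun_def algebra_simps)

lemma VF_TM: "X \<in> VF \<Longrightarrow> X p \<in> TM p"
  by (simp add: vector_fields_def)

text \<open>Tangent vectors vanish on functions that are not smooth, so this holds for every
  \<open>f\<close> and later computations carry no smoothness side condition on
  \<open>f\<close>.\<close>

lemma VF_SF: assumes "X \<in> VF" shows "(\<lambda>p. X p f) \<in> SF"
proof (cases "f \<in> SF")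
  case True
  then show ?thesis using assms by (simp add: vector_fields_def)
next
  case False
  then show ?thesis using TM_not_smooth[OF VF_TM[OF assms]] SF_const[of 0] by simp
qed

lemma VF_I: "(\<And>p. X p \<in> TM p) \<Longrightarrow> (\<And>f. f \<in> SF \<Longrightarrow> (\<lambda>p. X p f) \<in> SF) \<Longrightarrow> X \<in> VF"
  by (simp add: vector_fields_def)

lemma VF_add: "X \<in> VF \<Longrightarrow> Y \<in> VF \<Longrightarrow> X + Y \<in> VF"
  by (rule VF_I) (simp_all add: subspace_add[OF subspace_TM] VF_TM SF_add VF_SF)

lemma VF_scale: "f \<in> SF \<Longrightarrow> X \<in> VF \<Longrightarrow> (\<lambda>p. f p *\<^sub>R X p) \<in> VF"
  by (rule VF_I) (simp add: subspace_scale[OF subspace_TM] VF_TM, simp add: scaleR_fun_def SF_mult VF_SF)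

lemma VF_cscale: "X \<in> VF \<Longrightarrow> c *\<^sub>R X \<in> VF"
  using VF_scale[OF SF_const, of X c] by (simp add: scaleR_fun_def)

lemma subspace_VF: "subspace VF"
proof -
  have "0 \<in> VF"
    by (rule VF_I) (simp_all add: subspace_0[OF subspace_TM] SF_const)
  then show ?thesis by (simp add: subspace_def VF_add VF_cscale)
qed

lemmas VF_diff = subspace_diff[OF subspace_VF] and VF_sum = subspace_sum[OF subspace_VF]

section \<open>Local frames\<close>

definition extend_by_zero :: "'m set \<Rightarrow> ('m \<Rightarrow> 'e) \<Rightarrow> 'e set \<Rightarrow> ('e \<Rightarrow> real) \<Rightarrow> 'm \<Rightarrow> real"
  where "extend_by_zero U \<phi> W G q = (if q \<in> U \<and> \<phi> q \<in> W then G (\<phi> q) else 0)"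

lemma extend_by_zero_outside: "\<not> (q \<in> U \<and> \<phi> q \<in> W) \<Longrightarrow> extend_by_zero U \<phi> W G q = 0"
  by (auto simp: extend_by_zero_def)

text \<open>Any chart domain is covered by two open sets: the points that \<open>\<phi>\<close>
  sends into \<open>W\<close>, where a transition map reduces the claim to \<open>G\<close>, and the
  complement of the support, where the function is 0. The support is compact, hence closed because
  the manifold is Hausdorff.\<close>

lemma SF_extend_by_zero:
  assumes U: "(U, \<phi>) \<in> A" and W: "open W" "W \<subseteq> \<phi> ` U" and K: "compact K" "K \<subseteq> W"
    and G: "smooth_on W G" "\<And>x. x \<in> W \<Longrightarrow> x \<notin> K \<Longrightarrow> G x = 0"
  shows "extend_by_zero U \<phi> W G \<in> SF"
  unfolding SF_iff
proof clarify
  fix V \<psi> assume V: "(V, \<psi>) \<in> A"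
  let ?f = "\<lambda>x. extend_by_zero U \<phi> W G (inv_into V \<psi> x)"
  define U' where "U' = U \<inter> \<phi> -` W"
  define K' where "K' = inv_into U \<phi> ` K"
  have "compact K'"
    unfolding K'_def
    using chart(4)[OF U] K W by (intro compact_continuous_image) (auto intro: continuous_on_subset)
  then have K': "closed K'" by (rule compact_imp_closed)
  have U': "open U'"
    unfolding U'_def using continuous_open_preimage[OF chart(3,1)[OF U] W(1)] .
  have o1: "open (\<psi> ` (V \<inter> U'))" and o2: "open (\<psi> ` (V - K'))"
    using open_chart_image[OF V] chart(1)[OF V] U' K' by auto
  have inv: "inv_into V \<psi> (\<psi> q) = q" if "q \<in> V" for q
    using chart(5)[OF V] that by simp
  have "smooth_on (\<psi> ` (V \<inter> U')) (\<lambda>x. G ((\<phi> \<circ> inv_into V \<psi>) x))"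
  proof (rule smooth_on_compose[OF o1 G(1)])
    show "smooth_on (\<psi> ` (V \<inter> U')) (\<phi> \<circ> inv_into V \<psi>)"
      by (rule smooth_on_subset[OF smooth_transition[OF V U]]) (auto simp: U'_def)
    show "(\<phi> \<circ> inv_into V \<psi>) ` \<psi> ` (V \<inter> U') \<subseteq> W"
      by (auto simp: U'_def inv)
  qed
  then have "smooth_on (\<psi> ` (V \<inter> U')) ?f"
    by (rule smooth_on_cong[OF o1, rotated]) (auto simp: U'_def inv extend_by_zero_def)
  moreover have "smooth_on (\<psi> ` (V - K')) ?f"
  proof (rule smooth_on_cong[OF o2 _ smooth_on_const])
    fix x assume "x \<in> \<psi> ` (V - K')"
    then obtain q where q: "q \<in> V" "q \<notin> K'" "x = \<psi> q" by blast
    have "\<phi> q \<notin> K" if "q \<in> U"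
      using q(2) that chart(5)[OF U] unfolding K'_def by (metis imageI inv_into_f_f)
    then show "0 = ?f x" using q G(2) by (auto simp: inv extend_by_zero_def)
  qed
  moreover have "\<psi> ` V = \<psi> ` (V \<inter> U') \<union> \<psi> ` (V - K')"
  proof -
    have "K' \<subseteq> U'"
      using K W(2) chart(5)[OF U] by (auto simp: K'_def U'_def inv_into_into f_inv_into_f subset_iff)
    then show ?thesis by blast
  qed
  ultimately show "smooth_on (\<psi> ` V) ?f"
    using smooth_on_Un[OF o1 o2] by simp
qed

text \<open>The partial derivative in direction \<open>i\<close> of the chart, cut off by
  \<open>\<rho>\<close> so that it is defined globally. The case distinction on \<open>f\<close>
  respects the convention that tangent vectors vanish on functions that are not smooth.\<close>

definition coordinate_field ::
  "'m set \<Rightarrow> ('m \<Rightarrow> 'e) \<Rightarrow> 'e set \<Rightarrow> ('e \<Rightarrow> real) \<Rightarrow> 'e \<Rightarrow> 'm vfield"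
  where "coordinate_field U \<phi> W \<rho> i q f = (if f \<in> SF then extend_by_zero U \<phi> W
     (\<lambda>x. \<rho> x * frechet_derivative (\<lambda>x. f (inv_into U \<phi> x)) (at x) i) q else 0)"

lemma VF_coordinate_field:
  assumes U: "(U, \<phi>) \<in> A" and W: "open W" "W \<subseteq> \<phi> ` U" and K: "compact K" "K \<subseteq> W"
    and \<rho>: "smooth_on W \<rho>" "\<And>x. x \<in> W \<Longrightarrow> x \<notin> K \<Longrightarrow> \<rho> x = 0"
  shows "coordinate_field U \<phi> W \<rho> i \<in> VF"
proof (rule VF_I)
  fix f assume f: "f \<in> SF"
  have "smooth_on W (\<lambda>x. f (inv_into U \<phi> x))"
    using f U W(2) unfolding SF_iff by (auto intro: smooth_on_subset)
  then have "extend_by_zero U \<phi> W (\<lambda>x. \<rho> x * frechet_derivative (\<lambda>x. f (inv_into U \<phi> x)) (at x) i) \<in> SF"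
    by (intro SF_extend_by_zero[OF U W K] smooth_on_mult[OF W(1) \<rho>(1)] smooth_on_frechet_derivative)
      (simp_all add: \<rho>(2))
  then show "(\<lambda>q. coordinate_field U \<phi> W \<rho> i q f) \<in> SF"
    using f by (simp add: coordinate_field_def)
next
  fix q
  let ?D = "\<lambda>f. frechet_derivative (\<lambda>x. f (inv_into U \<phi> x)) (at (\<phi> q))"
  show "coordinate_field U \<phi> W \<rho> i q \<in> TM q"
  proof (cases "q \<in> U \<and> \<phi> q \<in> W")
    case False
    then have "coordinate_field U \<phi> W \<rho> i q = 0"
      by (auto simp: coordinate_field_def extend_by_zero_def fun_eq_iff)
    then show ?thesis by (simp add: subspace_0[OF subspace_TM])
  next
    case True
    then have inv: "inv_into U \<phi> (\<phi> q) = q" using chart(5)[OF U] by simp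
    have E: "coordinate_field U \<phi> W \<rho> i q f = \<rho> (\<phi> q) * ?D f i" if "f \<in> SF" for f
      using True that by (simp add: coordinate_field_def extend_by_zero_def)
    have D: "((\<lambda>x. f (inv_into U \<phi> x)) has_derivative ?D f) (at (\<phi> q))" if "f \<in> SF" for f
      using that U True smooth_on_has_derivative[of "\<phi> ` U"] unfolding SF_iff by blast
    have add: "frechet_derivative (\<lambda>x. f (inv_into U \<phi> x) + g (inv_into U \<phi> x)) (at (\<phi> q)) i = ?D f i + ?D g i" if "f \<in> SF" "g \<in> SF" for f g
      using frechet_derivative_at[OF has_derivative_add[OF D D, OF that]]
      by (simp add: plus_fun_def fun_eq_iff)
    have scale: "?D (c *\<^sub>R f) i = c * ?D f i" if "f \<in> SF" for f c
      using frechet_derivative_at[OF has_derivative_mult_right[OF D, OF that], of c]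
      by (simp add: scaleR_fun_def fun_eq_iff)
    have mult: "frechet_derivative (\<lambda>x. f (inv_into U \<phi> x) * g (inv_into U \<phi> x)) (at (\<phi> q)) i = f q * ?D g i + ?D f i * g q" if "f \<in> SF" "g \<in> SF" for f g
      using frechet_derivative_at[OF has_derivative_mult[OF D D, OF that]]
      by (simp add: times_fun_def fun_eq_iff inv)
    have cl: "f + g \<in> SF" "f * g \<in> SF" "c *\<^sub>R f \<in> SF" if "f \<in> SF" "g \<in> SF" for f g c
      using that SF_add SF_mult SF_cmult by (simp_all add: plus_fun_def times_fun_def scaleR_fun_def)
    have E0: "coordinate_field U \<phi> W \<rho> i q f = 0" if "f \<notin> SF" for f
      using that by (simp add: coordinate_field_def)
    show ?thesis
      unfolding tangent_space_def
      by (simp add: E E0 cl add scale mult algebra_simps)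
  qed
qed

text \<open>A global substitute for a frame near \<open>p\<close>: after multiplication by
  \<open>w\<close>, every tangent vector at every point is a combination of finitely many global
  fields, with coefficients obtained by applying it to global functions. Multiplying by
  \<open>w\<close> instead of dividing keeps everything smooth on the whole manifold.\<close>

lemma local_frame:
  obtains w I h X where "finite I" "w \<in> SF" "w p \<noteq> 0"
    "\<And>i. i \<in> I \<Longrightarrow> h i \<in> SF" "\<And>i. i \<in> I \<Longrightarrow> X i \<in> VF"
    "\<And>q v. v \<in> TM q \<Longrightarrow> w q *\<^sub>R v = (\<Sum>i\<in>(I :: 'e set). v (h i) *\<^sub>R X i q)"
proof -
  obtain U \<phi> where U: "(U, \<phi>) \<in> A" and p: "p \<in> U" by (rule chart_around)
  obtain R where R: "R > 0" "ball (\<phi> p) R \<subseteq> \<phi> ` U"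
    using chart(2)[OF U] p by (metis imageI open_contains_ball_eq)
  define W where "W = ball (\<phi> p) R"
  define K where "K = cball (\<phi> p) (R / 2)"
  have W: "open W" "W \<subseteq> \<phi> ` U" "convex W" and K: "compact K" "K \<subseteq> W"
    using R by (auto simp: W_def K_def)
  obtain \<rho> where \<rho>: "smooth_on UNIV \<rho>" "\<rho> (\<phi> p) \<noteq> (0::real)" "\<And>x. x \<notin> K \<Longrightarrow> \<rho> x = 0"
    using smooth_bump[of "R / 2" "\<phi> p"] R(1) unfolding K_def by auto
  have \<rho>W: "smooth_on W \<rho>" using smooth_on_subset[OF \<rho>(1)] by simp
  let ?e = "extend_by_zero U \<phi> W"
  define r where "r = ?e \<rho>"
  define x where "x i = ?e (\<lambda>x. (x \<bullet> i) * \<rho> x)" for i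
  define E where "E = coordinate_field U \<phi> W \<rho>"
  have ext: "?e (\<lambda>x. G x * \<rho> x) \<in> SF" if "smooth_on W G" for G
    by (intro SF_extend_by_zero[OF U W(1,2) K] smooth_on_mult[OF W(1) that \<rho>W]) (simp add: \<rho>(3))
  have rSF: "r \<in> SF" using ext[OF smooth_on_const, of 1] by (simp add: r_def)
  have xSF: "x i \<in> SF" for i
    unfolding x_def
    by (intro ext smooth_on_bounded_linear[OF W(1) bounded_linear_inner_left] smooth_on_id W(1))
  have EVF: "E i \<in> VF" for i
    unfolding E_def using VF_coordinate_field[OF U W(1,2) K \<rho>W] \<rho>(3) by blast
  \<comment> \<open>Apply \<open>v\<close> to Hadamard's expansion of \<open>f - f q\<close>
    multiplied by \<open>r^2\<close>: one factor \<open>r\<close> cuts off the coordinates, the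
    other the coefficients \<open>g i\<close>. The cut-off coordinate differences vanish at
    \<open>q\<close>, so by the product rule only the values of the coefficients at \<open>q\<close>
    survive.\<close>
  have key: "r q ^ 2 * v f = (\<Sum>i\<in>Basis. (v (x i) - (\<phi> q \<bullet> i) * v r) * E i q f)"
    if v: "v \<in> TM q" and f: "f \<in> SF" for q v f
  proof (cases "q \<in> U \<and> \<phi> q \<in> W")
    case False
    then have "?e G q = 0" for G by (rule extend_by_zero_outside)
    then show ?thesis
      by (simp add: f r_def E_def coordinate_field_def)
  next
    case True
    then have inv: "inv_into U \<phi> (\<phi> q) = q" using chart(5)[OF U] by simp
    have "smooth_on W (\<lambda>x. f (inv_into U \<phi> x))"
      using f U W(2) unfolding SF_iff by (auto intro: smooth_on_subset)
    then obtain g where g: "\<And>i. smooth_on W (g i)"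
        "\<And>i. g i (\<phi> q) = frechet_derivative (\<lambda>x. f (inv_into U \<phi> x)) (at (\<phi> q)) i"
        "\<And>y. y \<in> W \<Longrightarrow> f (inv_into U \<phi> y) = f (inv_into U \<phi> (\<phi> q))
           + (\<Sum>i\<in>Basis. ((y - \<phi> q) \<bullet> i) * g i y)"
      using hadamard[OF W(1,3)] True by blast
    define k where "k i = ?e (\<lambda>x. g i x * \<rho> x)" for i
    have kSF: "k i \<in> SF" for i unfolding k_def by (rule ext[OF g(1)])
    have kq: "k i q = E i q f" for i
      using f True by (simp add: k_def E_def coordinate_field_def extend_by_zero_def g(2))
    have xq: "x i q = (\<phi> q \<bullet> i) * r q" for i
      using True by (simp add: x_def r_def extend_by_zero_def)
    have "(r m * r m) * (f m - f q) = (\<Sum>i\<in>Basis. (x i m - (\<phi> q \<bullet> i) * r m) * k i m)" for m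
    proof (cases "m \<in> U \<and> \<phi> m \<in> W")
      case False
      then show ?thesis by (simp add: r_def k_def extend_by_zero_outside)
    next
      case m: True
      then have "inv_into U \<phi> (\<phi> m) = m" using chart(5)[OF U] by simp
      then have "f m - f q = (\<Sum>i\<in>Basis. ((\<phi> m - \<phi> q) \<bullet> i) * g i (\<phi> m))"
        using g(3)[of "\<phi> m"] m inv by simp
      then show ?thesis
        using m by (simp add: r_def k_def x_def extend_by_zero_def sum_distrib_left inner_diff_left
            algebra_simps)
    qed
    then have "v (\<lambda>m. (r m * r m) * (f m - f q)) = v (\<lambda>m. \<Sum>i\<in>Basis. (x i m - (\<phi> q \<bullet> i) * r m) * k i m)"
      by simp
    moreover have "v (\<lambda>m. (r m * r m) * (f m - f q)) = r q ^ 2 * v f"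
      by (simp add: TM_mult[OF v SF_mult[OF rSF rSF] SF_diff[OF f SF_const]]
          TM_diff[OF v f SF_const] TM_const[OF v] power2_eq_square)
    moreover have "v (\<lambda>m. \<Sum>i\<in>Basis. (x i m - (\<phi> q \<bullet> i) * r m) * k i m)
        = (\<Sum>i\<in>Basis. (v (x i) - (\<phi> q \<bullet> i) * v r) * E i q f)"
    proof -
      have s: "(\<lambda>m. x i m - (\<phi> q \<bullet> i) * r m) \<in> SF" for i
        by (intro SF_diff SF_cmult xSF rSF)
      show ?thesis
        by (simp add: TM_sum[OF v SF_mult[OF s kSF]] TM_mult[OF v s kSF] kq xq
            TM_diff[OF v xSF SF_cmult[OF rSF]] TM_cmult[OF v rSF])
    qed
    ultimately show ?thesis by simp
  qed
  \<comment> \<open>The vector 0 is not in \<open>Basis\<close> and serves as an extra index, for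
    the terms with \<open>v r\<close>. Their coefficient \<open>\<phi> q \<bullet> i\<close> is only
    local; a third factor \<open>r\<close> turns it into the global function \<open>x i\<close>,
    which is why \<open>w\<close> is the cube of \<open>r\<close>.\<close>
  define h where "h i = (if i = 0 then r else x i)" for i
  define X where "X i = (if i = 0 then \<Sum>j\<in>Basis. (\<lambda>q. (- x j q) *\<^sub>R E j q) else (\<lambda>q. r q *\<^sub>R E i q))" for i
  show thesis
  proof (rule that)
    show "finite (insert 0 Basis :: 'e set)" by simp
    show "(\<lambda>q. r q ^ 3) \<in> SF"
      unfolding power3_eq_cube by (intro SF_mult rSF)
    show "r p ^ 3 \<noteq> 0"
      using p \<rho>(2) R(1) by (simp add: r_def extend_by_zero_def W_def)
    show "h i \<in> SF" for i by (simp add: h_def rSF xSF)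
    show "X i \<in> VF" for i
    proof -
      have "(\<Sum>j\<in>Basis. (\<lambda>q. (- x j q) *\<^sub>R E j q)) \<in> VF"
        by (intro VF_sum VF_scale SF_uminus xSF EVF)
      moreover have "(\<lambda>q. r q *\<^sub>R E i q) \<in> VF" by (intro VF_scale rSF EVF)
      ultimately show ?thesis unfolding X_def by (cases "i = 0") (simp_all only: simp_thms if_True if_False)
    qed
    show "r q ^ 3 *\<^sub>R v = (\<Sum>i\<in>insert 0 Basis. v (h i) *\<^sub>R X i q)" if v: "v \<in> TM q" for q v
    proof
      fix f
      have xr: "(\<phi> q \<bullet> i) * r q * E i q f = x i q * E i q f" for i
        by (simp add: x_def r_def E_def coordinate_field_def extend_by_zero_def)
      have "r q ^ 3 * v f = (\<Sum>i\<in>Basis. v (x i) * (r q * E i q f)) - v r * (\<Sum>i\<in>Basis. x i q * E i q f)"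
      proof (cases "f \<in> SF")
        case True
        have "r q ^ 3 * v f = r q * (r q ^ 2 * v f)" by (simp add: power3_eq_cube power2_eq_square)
        also have "\<dots> = (\<Sum>i\<in>Basis. v (x i) * (r q * E i q f) - v r * ((\<phi> q \<bullet> i) * r q * E i q f))"
          unfolding key[OF v True] by (simp add: sum_distrib_left algebra_simps)
        finally show ?thesis unfolding xr by (simp add: sum_subtractf sum_distrib_left)
      next
        case False
        then show ?thesis by (simp add: TM_not_smooth[OF v] E_def coordinate_field_def)
      qed
      moreover have "(\<Sum>i\<in>insert 0 Basis. v (h i) *\<^sub>R X i q) f
          = v r * X 0 q f + (\<Sum>i\<in>Basis. v (x i) * (r q * E i q f))"
      proof -
        have "(\<Sum>i\<in>Basis. v (h i) * X i q f) = (\<Sum>i\<in>Basis. v (x i) * (r q * E i q f))"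
          by (rule sum.cong) (auto simp: h_def X_def scaleR_fun_def)
        then show ?thesis
          by (simp add: sum_fun_apply scaleR_fun_def h_def)
      qed
      moreover have "X 0 q f = - (\<Sum>i\<in>Basis. x i q * E i q f)"
        by (simp add: X_def sum_fun_apply scaleR_fun_def sum_negf)
      ultimately show "(r q ^ 3 *\<^sub>R v) f = (\<Sum>i\<in>insert 0 Basis. v (h i) *\<^sub>R X i q) f"
        by (simp add: scaleR_fun_def)
    qed
  qed
qed

end

section \<open>Traces of tensor fields\<close>

lemma scaleR_fun_apply: "(c *\<^sub>R f) x = c *\<^sub>R f x"
  by (simp add: scaleR_fun_def)

text \<open>The basis is chosen for \<open>V\<close> alone, before \<open>L\<close> is given; this
  is what makes traces of different maps comparable and the trace additive.\<close>

lemma endo_trace_basis: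
  "\<exists>B. B \<subseteq> V \<and> independent B \<and> V \<subseteq> span B \<and>
    endo_trace V = (\<lambda>L. \<Sum>b\<in>B. representation B (L b) b)"
proof -
  let ?P = "\<lambda>B. B \<subseteq> V \<and> independent B \<and> V \<subseteq> span B"
  have "?P (SOME B. ?P B)"
    by (rule someI_ex) (meson maximal_independent_subset)
  then show ?thesis
    by (intro exI[of _ "SOME B. ?P B"]) (simp add: endo_trace_def Let_def fun_eq_iff)
qed

lemma endo_trace_cong:
  assumes "\<And>v. v \<in> V \<Longrightarrow> L v = L' v"
  shows "endo_trace V L = endo_trace V L'"
proof -
  obtain B where "B \<subseteq> V" "endo_trace V = (\<lambda>L. \<Sum>b\<in>B. representation B (L b) b)"
    using endo_trace_basis[of V] by blast
  then show ?thesis using assms by (auto intro!: sum.cong)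
qed

lemma endo_trace_add:
  assumes "\<And>v. L v \<in> V" "\<And>v. L' v \<in> V"
  shows "endo_trace V (\<lambda>v. L v + L' v) = endo_trace V L + endo_trace V L'"
proof -
  obtain B where B: "B \<subseteq> V" "independent B" "V \<subseteq> span B"
    "endo_trace V = (\<lambda>L. \<Sum>b\<in>B. representation B (L b) b)"
    using endo_trace_basis[of V] by blast
  have "representation B (L b + L' b) b = representation B (L b) b + representation B (L' b) b" for b
    using representation_add[OF B(2)] B(3) assms by (metis subsetD)
  then show ?thesis by (simp add: B(4) sum.distrib)
qed

context smooth_atlas
begin

section \<open>Operators linear over the smooth functions, and their values at a point\<close>

definition SF_linear :: "('m vfield \<Rightarrow> 'm vfield) \<Rightarrow> bool"
  where "SF_linear L \<longleftrightarrow> (\<forall>Y\<in>VF. L Y \<in> VF) \<and> (\<forall>Y\<in>VF. \<forall>Z\<in>VF. L (Y + Z) = L Y + L Z) \<and>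
    (\<forall>f\<in>SF. \<forall>Y\<in>VF. L (\<lambda>p. f p *\<^sub>R Y p) = (\<lambda>p. f p *\<^sub>R L Y p))"

lemma SF_linearD:
  assumes "SF_linear L"
  shows "Y \<in> VF \<Longrightarrow> L Y \<in> VF" "Y \<in> VF \<Longrightarrow> Z \<in> VF \<Longrightarrow> L (Y + Z) = L Y + L Z"
    "f \<in> SF \<Longrightarrow> Y \<in> VF \<Longrightarrow> L (\<lambda>p. f p *\<^sub>R Y p) = (\<lambda>p. f p *\<^sub>R L Y p)"
  using assms by (auto simp: SF_linear_def)

lemma SF_linear_cscale:
  assumes "SF_linear L" "Y \<in> VF" shows "L (c *\<^sub>R Y) = c *\<^sub>R L Y"
  using SF_linearD(3)[OF assms(1) SF_const assms(2), of c] by (simp add: scaleR_fun_def)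

lemma SF_linear_0: "SF_linear L \<Longrightarrow> L 0 = 0"
  using SF_linear_cscale[of L 0 0] subspace_0[OF subspace_VF] by simp

lemma SF_linear_uminus: "SF_linear L \<Longrightarrow> Y \<in> VF \<Longrightarrow> L (- Y) = - L Y"
  using SF_linear_cscale[of L Y "-1"] by simp

lemma SF_linear_diff:
  assumes "SF_linear L" "Y \<in> VF" "Z \<in> VF" shows "L (Y - Z) = L Y - L Z"
  using SF_linearD(2)[OF assms(1,2) subspace_neg[OF subspace_VF assms(3)]]
    SF_linear_uminus[OF assms(1,3)] by simp

lemma SF_linear_sum:
  assumes "SF_linear L" "\<And>i. i \<in> I \<Longrightarrow> Y i \<in> VF"
  shows "L (\<Sum>i\<in>I. Y i) = (\<Sum>i\<in>I. L (Y i))"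
  using assms(2)
  by (induction I rule: infinite_finite_induct)
     (auto simp: SF_linear_0[OF assms(1)] SF_linearD(2)[OF assms(1)] VF_sum)

lemma SF_linear_compose: "SF_linear L \<Longrightarrow> SF_linear L' \<Longrightarrow> SF_linear (\<lambda>Y. L (L' Y))"
  by (simp add: SF_linear_def)

lemma SF_linear_minus: "SF_linear L \<Longrightarrow> SF_linear (\<lambda>Y. - L Y)"
  by (simp add: SF_linear_def subspace_neg[OF subspace_VF] fun_eq_iff[where f="- _"])

lemma SF_linear_subtract: "SF_linear L \<Longrightarrow> SF_linear L' \<Longrightarrow> SF_linear (\<lambda>Y. L Y - L' Y)"
  by (auto simp: SF_linear_def VF_diff fun_eq_iff[where f="_ - _"] scaleR_diff_right)

text \<open>By \<open>local_frame\<close>, \<open>w\<close> times \<open>Y\<close> is a combination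
  of global fields whose coefficients \<open>Y q (h i)\<close> vanish at \<open>q = p\<close>; these
  coefficients pass through \<open>L\<close>, and \<open>w p\<close> is not 0.\<close>

lemma SF_linear_eq_0_at:
  assumes L: "SF_linear L" and Y: "Y \<in> VF" "Y p = 0"
  shows "L Y p = 0"
proof -
  obtain w I h X where fr: "w \<in> SF" "w p \<noteq> 0"
    "\<And>i. i \<in> I \<Longrightarrow> h i \<in> SF" "\<And>i. i \<in> I \<Longrightarrow> X i \<in> VF"
    "\<And>q v. v \<in> TM q \<Longrightarrow> w q *\<^sub>R v = (\<Sum>i\<in>(I :: 'e set). v (h i) *\<^sub>R X i q)"
    by (rule local_frame[of p]) blast
  have expand: "(\<lambda>q. w q *\<^sub>R Y q) = (\<Sum>i\<in>I. (\<lambda>q. Y q (h i) *\<^sub>R X i q))"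
    by (rule ext) (simp add: sum_fun_apply fr(5)[OF VF_TM[OF Y(1)]])
  have "L (\<lambda>q. w q *\<^sub>R Y q) = (\<Sum>i\<in>I. L (\<lambda>q. Y q (h i) *\<^sub>R X i q))"
    unfolding expand by (rule SF_linear_sum[OF L]) (intro VF_scale VF_SF Y(1) fr(4))
  from fun_cong[OF this, of p] have "w p *\<^sub>R L Y p = (\<Sum>i\<in>I. Y p (h i) *\<^sub>R L (X i) p)"
    by (simp add: sum_fun_apply SF_linearD(3)[OF L fr(1) Y(1)]
        SF_linearD(3)[OF L VF_SF[OF Y(1)] fr(4)])
  then show ?thesis using fr(2) by (simp add: Y(2))
qed

lemma SF_linear_local:
  assumes "SF_linear L" "Y \<in> VF" "Z \<in> VF" "Y p = Z p"
  shows "L Y p = L Z p"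
  using SF_linear_eq_0_at[OF assms(1) VF_diff[OF assms(2,3)], of p] assms(4)
  by (simp add: SF_linear_diff[OF assms(1-3)])

text \<open>Freezing the coefficients of the frame expansion at \<open>p\<close> gives a constant
  combination of global fields. Hence the choice in \<open>at_point\<close> succeeds for every
  tangent vector.\<close>

lemma vector_field_through:
  assumes v: "v \<in> TM p"
  shows "\<exists>Y\<in>VF. Y p = v"
proof -
  obtain w I h X where fr: "w p \<noteq> 0" "\<And>i. i \<in> I \<Longrightarrow> X i \<in> VF"
    "\<And>q v. v \<in> TM q \<Longrightarrow> w q *\<^sub>R v = (\<Sum>i\<in>(I :: 'e set). v (h i) *\<^sub>R X i q)"
    by (rule local_frame[of p]) blast
  let ?Y = "\<Sum>i\<in>I. (v (h i) / w p) *\<^sub>R X i"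
  have "?Y \<in> VF" by (intro VF_sum VF_cscale fr(2))
  moreover have "?Y p = (1 / w p) *\<^sub>R (\<Sum>i\<in>I. v (h i) *\<^sub>R X i p)"
    by (simp add: sum_fun_apply scaleR_fun_apply scaleR_sum_right)
  then have "?Y p = v" by (simp add: fr(1) fr(3)[OF v, symmetric])
  ultimately show ?thesis by blast
qed

lemma at_point_cong:
  assumes "\<And>Y. Y \<in> VF \<Longrightarrow> L Y = L' Y" and "v \<in> TM p"
  shows "at_point A L p v = at_point A L' p v"
proof -
  have "\<exists>Y. Y \<in> VF \<and> Y p = v" using vector_field_through[OF assms(2)] by blast
  then have "(SOME Y. Y \<in> VF \<and> Y p = v) \<in> VF" by (rule someI2_ex) blast
  then show ?thesis by (simp add: at_point_def assms(1))
qed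

text \<open>The frame fields at \<open>p\<close> are a finite spanning set. Finiteness matters for
  \<open>endo_trace\<close>, whose sum over an infinite basis would be 0 by default.\<close>

lemma finite_independent_TM:
  assumes "independent B" "B \<subseteq> TM p"
  shows "finite B"
proof -
  obtain w I h X where fr: "finite I" "w p \<noteq> 0"
    "\<And>q v. v \<in> TM q \<Longrightarrow> w q *\<^sub>R v = (\<Sum>i\<in>(I :: 'e set). v (h i) *\<^sub>R X i q)"
    by (rule local_frame[of p]) blast
  have "B \<subseteq> span ((\<lambda>i. X i p) ` I)"
  proof
    fix v assume "v \<in> B"
    then have "w p *\<^sub>R v = (\<Sum>i\<in>I. v (h i) *\<^sub>R X i p)" using fr(3) assms(2) by blast
    also have "\<dots> \<in> span ((\<lambda>i. X i p) ` I)" by (intro span_sum span_scale span_base imageI)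
    finally have "w p *\<^sub>R v \<in> span ((\<lambda>i. X i p) ` I)" .
    then have "(1 / w p) *\<^sub>R w p *\<^sub>R v \<in> span ((\<lambda>i. X i p) ` I)" by (rule span_scale)
    then show "v \<in> span ((\<lambda>i. X i p) ` I)" using fr(2) by simp
  qed
  then show ?thesis using independent_span_bound[OF _ assms(1)] fr(1) by blast
qed

text \<open>The trace of \<open>\<alpha> \<otimes> W\<close> with \<open>\<alpha> v = (L v) f\<close>; it does not depend on the basis in
  \<open>endo_trace\<close> nor on the extensions in \<open>at_point\<close>.\<close>

lemma endo_trace_rank_one:
  assumes L: "SF_linear L" and W: "W \<in> VF"
  shows "endo_trace (TM p) (at_point A (\<lambda>Y q. L Y q f *\<^sub>R W q) p) = L W p f"
proof -
  obtain B where B: "B \<subseteq> TM p" "independent B" "TM p \<subseteq> span B"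
    "endo_trace (TM p) = (\<lambda>L. \<Sum>b\<in>B. representation B (L b) b)"
    using endo_trace_basis[of "TM p"] by blast
  have fin: "finite B" using finite_independent_TM B(1,2) by blast
  \<comment> \<open>Exactly the extension that \<open>at_point\<close> selects for the basis vector
    \<open>b\<close>.\<close>
  define V where "V b = (SOME Y. Y \<in> VF \<and> Y p = b)" for b
  have "V b \<in> VF \<and> V b p = b" if "b \<in> B" for b
  proof -
    have "\<exists>Y. Y \<in> VF \<and> Y p = b" using vector_field_through[of b p] B(1) that by blast
    then show ?thesis unfolding V_def by (rule someI_ex)
  qed
  then have V: "V b \<in> VF" "V b p = b" if "b \<in> B" for b
    using that by blast+
  let ?c = "representation B (W p)"
  have Wp: "W p \<in> span B" using VF_TM[OF W] B(3) by blast
  have "endo_trace (TM p) (at_point A (\<lambda>Y q. L Y q f *\<^sub>R W q) p)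
      = (\<Sum>b\<in>B. representation B (L (V b) p f *\<^sub>R W p) b)"
    by (simp add: B(4) at_point_def V_def)
  also have "\<dots> = (\<Sum>b\<in>B. ?c b * L (V b) p f)"
    by (simp add: representation_scale[OF B(2) Wp] mult.commute)
  also have "\<dots> = L (\<Sum>b\<in>B. ?c b *\<^sub>R V b) p f"
  proof -
    have "L (\<Sum>b\<in>B. ?c b *\<^sub>R V b) = (\<Sum>b\<in>B. ?c b *\<^sub>R L (V b))"
      using SF_linear_sum[OF L, of B "\<lambda>b. ?c b *\<^sub>R V b"]
      by (simp add: VF_cscale V(1) SF_linear_cscale[OF L])
    then show ?thesis by (simp add: sum_fun_apply scaleR_fun_apply)
  qed
  \<comment> \<open>The combination of the selected extensions need not be \<open>W\<close>, but it
    agrees with \<open>W\<close> at \<open>p\<close>, and the value at \<open>p\<close> depends on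
    nothing else.\<close>
  also have "L (\<Sum>b\<in>B. ?c b *\<^sub>R V b) p = L W p"
  proof (rule SF_linear_local[OF L VF_sum[OF VF_cscale[OF V(1)]] W])
    have "(\<Sum>b\<in>B. ?c b *\<^sub>R V b) p = (\<Sum>b\<in>B. ?c b *\<^sub>R b)"
      by (simp add: sum_fun_apply scaleR_fun_apply V(2))
    also have "\<dots> = W p"
      by (rule real_vector.sum_representation_eq[OF B(2) Wp fin order_refl])
    finally show "(\<Sum>b\<in>B. ?c b *\<^sub>R V b) p = W p" .
  qed simp
  finally show ?thesis .
qed

section \<open>Endomorphism fields, brackets and torsion\<close>

lemma SF_linear_apply_field:
  assumes "E \<in> endo_fields A"
  shows "SF_linear (apply_field E)"
proof -
  have E: "endo_on (TM p) (E p)" for p using assms by (simp add: endo_fields_def)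
  show ?thesis
    unfolding SF_linear_def
    using assms E VF_TM by (auto simp: endo_fields_def apply_field_def endo_on_def fun_eq_iff)
qed

lemma lie_bracket_add:
  assumes "X \<in> VF" "Y \<in> VF" "Z \<in> VF"
  shows "lie_bracket (X + Y) Z = lie_bracket X Z + lie_bracket Y Z"
    "lie_bracket Z (X + Y) = lie_bracket Z X + lie_bracket Z Y"
  by (auto simp: lie_bracket_def fun_eq_iff TM_add[OF VF_TM VF_SF VF_SF] assms)

lemma connection_closed: "linear_connection A D \<Longrightarrow> X \<in> VF \<Longrightarrow> Y \<in> VF \<Longrightarrow> D X Y \<in> VF"
  by (simp add: linear_connection_def)

lemma connection_add:
  assumes "linear_connection A D" "X \<in> VF" "Y \<in> VF" "Z \<in> VF"
  shows "D (X + Y) Z = D X Z + D Y Z" "D Z (X + Y) = D Z X + D Z Y"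
  using assms by (auto simp: linear_connection_def)

lemma connection_scale:
  assumes "linear_connection A D" "f \<in> SF" "X \<in> VF" "Y \<in> VF"
  shows "D (\<lambda>p. f p *\<^sub>R X p) Y = (\<lambda>p. f p *\<^sub>R D X Y p)"
    "D X (\<lambda>p. f p *\<^sub>R Y p) = (\<lambda>p. X p f *\<^sub>R Y p + f p *\<^sub>R D X Y p)"
  using assms by (auto simp: linear_connection_def)

lemma torsion_add:
  assumes "linear_connection A D" "X \<in> VF" "Y \<in> VF" "Z \<in> VF"
  shows "torsion D (X + Y) Z = torsion D X Z + torsion D Y Z"
    "torsion D Z (X + Y) = torsion D Z X + torsion D Z Y"
  using assms by (simp_all add: torsion_def connection_add lie_bracket_add fun_eq_iff)

lemma torsion_diff:
  assumes "linear_connection A D" "X \<in> VF" "Y \<in> VF" "Z \<in> VF"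
  shows "torsion D (X - Y) Z = torsion D X Z - torsion D Y Z"
    "torsion D Z (X - Y) = torsion D Z X - torsion D Z Y"
  using torsion_add[OF assms(1) VF_diff[OF assms(2,3)] assms(3,4)] by simp_all

end

lemma torsion_antisym: "torsion D Y X = - torsion D X Y"
  by (simp add: torsion_def lie_bracket_def fun_eq_iff)

section \<open>Biparacomplex structures\<close>

lemma double_eq_0: "x + x = 0 \<Longrightarrow> x = 0" for x :: "'v::real_vector"
  by (simp add: scaleR_2[symmetric])

locale biparacomplex_manifold = smooth_atlas A
  for A :: "('m::{t2_space, second_countable_topology}, 'e::euclidean_space) atlas" +
  fixes F P :: "'m efield"
  assumes biparacomplex: "biparacomplex A F P"
begin

abbreviation "\<phi> \<equiv> apply_field F"
abbreviation "\<pi> \<equiv> apply_field P"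

lemma almost_biparacomplex: "almost_biparacomplex A F P"
  using biparacomplex by (simp add: biparacomplex_def)

lemma endo: "F \<in> endo_fields A" "P \<in> endo_fields A"
  using almost_biparacomplex by (simp_all add: almost_biparacomplex_def)

lemma linear: "SF_linear \<phi>" "SF_linear \<pi>"
  by (simp_all add: SF_linear_apply_field endo)

lemmas closed = SF_linearD(1)[OF linear(1)] SF_linearD(1)[OF linear(2)]
lemmas add = SF_linearD(2)[OF linear(1)] SF_linearD(2)[OF linear(2)]
lemmas diff = SF_linear_diff[OF linear(1)] SF_linear_diff[OF linear(2)]
lemmas neg = SF_linear_uminus[OF linear(1)] SF_linear_uminus[OF linear(2)]

lemma relations:
  assumes "X \<in> VF"
  shows "\<phi> (\<phi> X) = X" "\<pi> (\<pi> X) = X" "\<phi> (\<pi> X) = - \<pi> (\<phi> X)"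
proof -
  have *: "F p (F p (X p)) = X p" "P p (P p (X p)) = X p" "F p (P p (X p)) + P p (F p (X p)) = 0" for p
    using almost_biparacomplex VF_TM[OF assms, of p] unfolding almost_biparacomplex_def by blast+
  show "\<phi> (\<phi> X) = X" "\<pi> (\<pi> X) = X" "\<phi> (\<pi> X) = - \<pi> (\<phi> X)"
    using * by (auto simp: apply_field_def eq_neg_iff_add_eq_0 intro!: ext)
qed

lemma sections_plus: "X \<in> sections A (plus_distribution A E) \<longleftrightarrow> X \<in> VF \<and> apply_field E X = X"
  unfolding fun_eq_iff[of "apply_field E X" X]
  by (auto simp: sections_def plus_distribution_def VF_TM apply_field_def)

lemma sections_minus: "X \<in> sections A (minus_distribution A E) \<longleftrightarrow> X \<in> VF \<and> apply_field E X = - X"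
  unfolding fun_eq_iff[of "apply_field E X" "- X"]
  by (auto simp: sections_def minus_distribution_def VF_TM apply_field_def eq_neg_iff_add_eq_0)

text \<open>Twice \<open>X\<close> is the sum of \<open>X + \<phi> X\<close> and
  \<open>X - \<phi> X\<close>, which are sections of the two eigenbundles of \<open>F\<close>. Used
  in each argument of the torsion and of the difference of the connections to reduce to
  eigenfields.\<close>

lemma eigen_split_eq_0:
  assumes X: "X \<in> VF"
    and add: "\<And>Y Z. Y \<in> VF \<Longrightarrow> Z \<in> VF \<Longrightarrow> L (Y + Z) = L Y + (L Z :: 'v::real_vector)"
    and plus: "\<And>Y. Y \<in> VF \<Longrightarrow> \<phi> Y = Y \<Longrightarrow> L Y = 0"
    and minus: "\<And>Y. Y \<in> VF \<Longrightarrow> \<phi> Y = - Y \<Longrightarrow> L Y = 0"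
  shows "L X = 0"
proof (rule double_eq_0)
  have "L X + L X = L ((X + \<phi> X) + (X - \<phi> X))" using add[OF X X] by simp
  also have "\<dots> = L (X + \<phi> X) + L (X - \<phi> X)"
    by (intro add VF_add VF_diff X closed)
  also have "L (X + \<phi> X) = 0"
    by (intro plus) (simp_all add: VF_add X closed SF_linearD(2)[OF linear(1)] relations)
  also have "L (X - \<phi> X) = 0"
    by (intro minus) (simp_all add: VF_diff X closed diff relations)
  finally show "L X + L X = 0" by simp
qed

section \<open>Parallel endomorphism fields and the torsion on eigenbundles\<close>

lemma parallel:
  assumes "parallel_endo A D E" "X \<in> VF" "Y \<in> VF"
  shows "D X (apply_field E Y) = apply_field E (D X Y)"
  using assms by (simp add: parallel_endo_def covariant_deriv_endo_def)

text \<open>Covariant derivatives of a section stay in the eigenbundle because \<open>E\<close> is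
  parallel, and the bracket stays in it by involutivity.\<close>

lemma torsion_plus:
  assumes D: "linear_connection A D" "parallel_endo A D E" and E: "E \<in> endo_fields A"
    and inv: "involutive A (plus_distribution A E)"
    and X: "X \<in> VF" "apply_field E X = X" and Y: "Y \<in> VF" "apply_field E Y = Y"
  shows "torsion D X Y \<in> VF" "apply_field E (torsion D X Y) = torsion D X Y"
proof -
  have lb: "lie_bracket X Y \<in> VF" "apply_field E (lie_bracket X Y) = lie_bracket X Y"
    using inv[unfolded involutive_def, rule_format, of X Y] X Y by (simp_all add: sections_plus)
  have DV: "D X Y \<in> VF" "D Y X \<in> VF" using connection_closed[OF D(1)] X Y by blast+
  note E = SF_linear_apply_field[OF E]
  show "torsion D X Y \<in> VF" by (simp add: torsion_def VF_diff DV lb)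
  show "apply_field E (torsion D X Y) = torsion D X Y"
    using parallel[OF D(2) X(1) Y(1)] parallel[OF D(2) Y(1) X(1)] X Y
    by (simp add: torsion_def SF_linear_diff[OF E] VF_diff DV lb)
qed

lemma connection_uminus:
  assumes "linear_connection A D" "X \<in> VF" "Y \<in> VF"
  shows "D X (- Y) = - D X Y"
proof -
  have "D X 0 = 0" using connection_add(2)[OF assms(1) _ _ assms(2), of 0 0] subspace_0[OF subspace_VF] by simp
  then show ?thesis
    using connection_add(2)[OF assms(1) assms(3) subspace_neg[OF subspace_VF assms(3)] assms(2)]
    by (simp add: eq_neg_iff_add_eq_0 add.commute)
qed

lemma torsion_minus:
  assumes D: "linear_connection A D" "parallel_endo A D E" and E: "E \<in> endo_fields A"
    and inv: "involutive A (minus_distribution A E)"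
    and X: "X \<in> VF" "apply_field E X = - X" and Y: "Y \<in> VF" "apply_field E Y = - Y"
  shows "torsion D X Y \<in> VF" "apply_field E (torsion D X Y) = - torsion D X Y"
proof -
  have lb: "lie_bracket X Y \<in> VF" "apply_field E (lie_bracket X Y) = - lie_bracket X Y"
    using inv[unfolded involutive_def, rule_format, of X Y] X Y by (simp_all add: sections_minus)
  have DV: "D X Y \<in> VF" "D Y X \<in> VF" using connection_closed[OF D(1)] X Y by blast+
  note E = SF_linear_apply_field[OF E]
  show "torsion D X Y \<in> VF" by (simp add: torsion_def VF_diff DV lb)
  have "apply_field E (D X Y) = - D X Y" "apply_field E (D Y X) = - D Y X"
    using parallel[OF D(2) X(1) Y(1)] parallel[OF D(2) Y(1) X(1)] X Y
      connection_uminus[OF D(1)] by simp_all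
  then show "apply_field E (torsion D X Y) = - torsion D X Y"
    by (simp add: torsion_def SF_linear_diff[OF E] VF_diff DV lb)
qed

lemma canonical_torsion_free:
  assumes can: "canonical_connection A F P D" and "X \<in> VF" "Y \<in> VF"
  shows "torsion D X Y = 0"
proof -
  have D: "linear_connection A D" "parallel_endo A D F" "parallel_endo A D P"
    and inv: "involutive A (plus_distribution A F)" "involutive A (minus_distribution A F)"
      "involutive A (plus_distribution A P)" "involutive A (minus_distribution A P)"
    using can biparacomplex by (auto simp: canonical_connection_def biparacomplex_def)
  let ?T = "torsion D"
  have mixed: "?T X Y = 0" if "X \<in> VF" "\<phi> X = X" "Y \<in> VF" "\<phi> Y = - Y" for X Y
    using can that by (simp add: canonical_connection_def sections_plus sections_minus)
  have mixed': "?T X Y = 0" if "X \<in> VF" "\<phi> X = - X" "Y \<in> VF" "\<phi> Y = Y" for X Y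
    using mixed[of Y X] torsion_antisym[of D X Y] that by simp
  have pure: "?T X Y = 0 \<and> ?T (\<pi> X) (\<pi> Y) = 0"
    if X: "X \<in> VF" "\<phi> X = X" and Y: "Y \<in> VF" "\<phi> Y = Y" for X Y
  proof -
    let ?u = "?T X Y" and ?v = "?T (\<pi> X) (\<pi> Y)"
    have p: "\<pi> X \<in> VF" "\<phi> (\<pi> X) = - \<pi> X" "\<pi> Y \<in> VF" "\<phi> (\<pi> Y) = - \<pi> Y"
      using X Y by (simp_all add: closed relations)
    note u = torsion_plus[OF D(1,2) endo(1) inv(1) X Y]
    note v = torsion_minus[OF D(1,2) endo(1) inv(2) p]
    have 1: "?T (X + \<pi> X) (Y + \<pi> Y) = ?u + ?v" "?T (X - \<pi> X) (Y - \<pi> Y) = ?u + ?v"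
      using mixed[OF X p(3,4)] mixed'[OF p(1,2) Y]
      by (simp_all add: torsion_add[OF D(1)] torsion_diff[OF D(1)] VF_add VF_diff X Y p)
    have "\<pi> (?T (X + \<pi> X) (Y + \<pi> Y)) = ?T (X + \<pi> X) (Y + \<pi> Y)"
      by (intro torsion_plus(2)[OF D(1,3) endo(2) inv(3)])
        (simp_all add: VF_add X Y p add relations add.commute)
    moreover have "\<pi> (?T (X - \<pi> X) (Y - \<pi> Y)) = - ?T (X - \<pi> X) (Y - \<pi> Y)"
      by (intro torsion_minus(2)[OF D(1,3) endo(2) inv(4)])
        (simp_all add: VF_diff X Y p diff relations)
    ultimately have "?u + ?v = - (?u + ?v)" unfolding 1 by (rule trans[OF sym])
    then have s: "?u + ?v = 0" unfolding eq_neg_iff_add_eq_0 by (rule double_eq_0)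
    then have "\<phi> (?u + ?v) = 0" by (simp add: SF_linear_0[OF linear(1)])
    then have "?u = ?v" using u v by (simp add: add)
    then show ?thesis using s double_eq_0[of ?v] by simp
  qed
  have plus: "?T X Y = 0" if X: "X \<in> VF" "\<phi> X = X" and Y: "Y \<in> VF" for X Y
  proof (rule eigen_split_eq_0[where L="?T X", OF Y])
    show "?T X (Y + Z) = ?T X Y + ?T X Z" if "Y \<in> VF" "Z \<in> VF" for Y Z
      by (rule torsion_add(2)[OF D(1) that X(1)])
    show "?T X Y = 0" if "Y \<in> VF" "\<phi> Y = Y" for Y using pure[OF X that] ..
  qed (rule mixed[OF X])
  have minus: "?T X Y = 0" if X: "X \<in> VF" "\<phi> X = - X" and Y: "Y \<in> VF" for X Y
  proof (rule eigen_split_eq_0[where L="?T X", OF Y])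
    show "?T X (Y + Z) = ?T X Y + ?T X Z" if "Y \<in> VF" "Z \<in> VF" for Y Z
      by (rule torsion_add(2)[OF D(1) that X(1)])
    show "?T X Y = 0" if Y: "Y \<in> VF" "\<phi> Y = - Y" for Y
    proof -
      \<comment> \<open>\<open>P\<close> exchanges the eigenbundles of \<open>F\<close>, so the
        second half of \<open>pure\<close>, taken at the images under \<open>P\<close>, covers the
        minus bundle.\<close>
      have "\<phi> (\<pi> X) = \<pi> X" "\<phi> (\<pi> Y) = \<pi> Y"
        using X Y by (simp_all add: relations neg)
      then show ?thesis
        using pure[of "\<pi> X" "\<pi> Y"] X Y by (simp add: closed relations)
    qed
  qed (rule mixed'[OF X])
  show ?thesis
  proof (rule eigen_split_eq_0[where L="\<lambda>X. ?T X Y", OF assms(2)])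
    show "?T (X + Z) Y = ?T X Y + ?T Z Y" if "X \<in> VF" "Z \<in> VF" for X Z
      by (rule torsion_add(1)[OF D(1) that assms(3)])
  qed (simp_all add: plus minus assms(3))
qed

text \<open>The average of the rank-one endomorphism \<open>v \<mapsto> v f \<cdot> W\<close> over the group generated by \<open>F\<close> and
  \<open>P\<close>; the last sign is due to \<open>(F P)\<inverse> = - F P\<close>.\<close>

definition averaged_endo :: "('m \<Rightarrow> real) \<Rightarrow> 'm vfield \<Rightarrow> 'm efield"
  where "averaged_endo f W p v = v f *\<^sub>R W p + F p v f *\<^sub>R \<phi> W p + P p v f *\<^sub>R \<pi> W p
     + (- F p (P p v) f) *\<^sub>R \<phi> (\<pi> W) p"

lemma pointwise:
  assumes "v \<in> TM p"
  shows "F p v \<in> TM p" "P p v \<in> TM p" "F p (c *\<^sub>R v) = c *\<^sub>R F p v" "P p (c *\<^sub>R v) = c *\<^sub>R P p v"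
    "F p (F p v) = v" "P p (P p v) = v" "P p (F p v) = - F p (P p v)"
    "u \<in> TM p \<Longrightarrow> F p (u + v) = F p u + F p v" "u \<in> TM p \<Longrightarrow> P p (u + v) = P p u + P p v"
proof -
  have "endo_on (TM p) (F p)" "endo_on (TM p) (P p)"
    using endo by (simp_all add: endo_fields_def)
  then show "F p v \<in> TM p" "P p v \<in> TM p" "F p (c *\<^sub>R v) = c *\<^sub>R F p v" "P p (c *\<^sub>R v) = c *\<^sub>R P p v"
    "u \<in> TM p \<Longrightarrow> F p (u + v) = F p u + F p v" "u \<in> TM p \<Longrightarrow> P p (u + v) = P p u + P p v"
    using assms unfolding endo_on_def by blast+
  have "F p (F p v) = v \<and> P p (P p v) = v \<and> F p (P p v) + P p (F p v) = 0"
    using almost_biparacomplex assms unfolding almost_biparacomplex_def by blast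
  then show "F p (F p v) = v" "P p (P p v) = v" "P p (F p v) = - F p (P p v)"
    by (auto simp: eq_neg_iff_add_eq_0 add.commute)
qed

text \<open>Composing with \<open>F\<close> or \<open>P\<close> on either side permutes the four
  summands up to sign; the sign of the last one makes the results on both sides agree.\<close>

lemma averaged_endo_adjoint:
  assumes W: "W \<in> VF"
  shows "averaged_endo f W \<in> adjoint_sections A F P"
proof -
  have WT: "W p \<in> TM p" "\<phi> W p \<in> TM p" "\<pi> W p \<in> TM p" "\<phi> (\<pi> W) p \<in> TM p" for p
    by (intro VF_TM closed W)+
  have "apply_field (averaged_endo f W) X \<in> VF" if X: "X \<in> VF" for X
  proof -
    have "apply_field (averaged_endo f W) X = (\<lambda>p. X p f *\<^sub>R W p) + (\<lambda>p. \<phi> X p f *\<^sub>R \<phi> W p)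
        + (\<lambda>p. \<pi> X p f *\<^sub>R \<pi> W p) + (\<lambda>p. (- \<phi> (\<pi> X) p f) *\<^sub>R \<phi> (\<pi> W) p)"
      by (simp add: fun_eq_iff apply_field_def averaged_endo_def)
    also have "\<dots> \<in> VF"
      by (intro VF_add VF_scale SF_uminus VF_SF closed W X)
    finally show ?thesis .
  qed
  moreover have "endo_on (TM p) (averaged_endo f W p)" for p
    unfolding endo_on_def
  proof (intro conjI ballI allI)
    fix u v c assume uv: "u \<in> TM p" "v \<in> TM p"
    show "averaged_endo f W p (u + v) = averaged_endo f W p u + averaged_endo f W p v"
      using uv by (simp add: averaged_endo_def pointwise algebra_simps)
  next
    fix v c assume v: "v \<in> TM p"
    show "averaged_endo f W p v \<in> TM p"
      unfolding averaged_endo_def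
      by (intro subspace_add[OF subspace_TM] subspace_scale[OF subspace_TM] WT)
    show "averaged_endo f W p (c *\<^sub>R v) = c *\<^sub>R averaged_endo f W p v"
      using v by (simp add: averaged_endo_def pointwise scaleR_fun_apply scaleR_add_right scaleR_diff_right)
  qed
  moreover have "averaged_endo f W p (F p v) = F p (averaged_endo f W p v)"
    "averaged_endo f W p (P p v) = P p (averaged_endo f W p v)" if v: "v \<in> TM p" for p v
  proof -
    let ?u = "W p"
    have E: "averaged_endo f W p u = u f *\<^sub>R ?u + F p u f *\<^sub>R F p ?u + P p u f *\<^sub>R P p ?u
        + (- F p (P p u) f) *\<^sub>R F p (P p ?u)" for u
      by (simp add: averaged_endo_def apply_field_def)
    have lin: "F p (a *\<^sub>R ?u + b *\<^sub>R F p ?u + c *\<^sub>R P p ?u + d *\<^sub>R F p (P p ?u))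
        = a *\<^sub>R F p ?u + b *\<^sub>R ?u + c *\<^sub>R F p (P p ?u) + d *\<^sub>R P p ?u"
      "P p (a *\<^sub>R ?u + b *\<^sub>R F p ?u + c *\<^sub>R P p ?u + d *\<^sub>R F p (P p ?u))
        = a *\<^sub>R P p ?u + b *\<^sub>R (- F p (P p ?u)) + c *\<^sub>R ?u + d *\<^sub>R (- F p ?u)" for a b c d
      using WT(1) by (simp_all add: pointwise subspace_add[OF subspace_TM] subspace_scale[OF subspace_TM])
    have neg: "F p (- u) = - F p u" "P p (- u) = - P p u" if "u \<in> TM p" for u
      using pointwise(3,4)[OF that, of "-1"] by simp_all
    show "averaged_endo f W p (F p v) = F p (averaged_endo f W p v)"
      "averaged_endo f W p (P p v) = P p (averaged_endo f W p v)"
      unfolding E lin using v by (simp_all add: pointwise neg)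
  qed
  ultimately show ?thesis by (simp add: adjoint_sections_def endo_fields_def)
qed

section \<open>Comparison of the two connections\<close>

text \<open>Following \<open>g\<close> by the averaged endomorphism gives four rank-one maps. Each
  of their traces is the value on \<open>f\<close> of an operator applied to one of the four
  translates of \<open>W\<close>; as \<open>f\<close> and \<open>p\<close> are arbitrary, the scalar
  condition becomes an identity of fields.\<close>

lemma trace_condition:
  assumes g: "SF_linear g" and W: "W \<in> VF"
    and tr: "\<And>f p. endo_trace (TM p) (at_point A (\<lambda>Y. apply_field (averaged_endo f W) (g Y)) p) = 0"
  shows "g W + \<phi> (g (\<phi> W)) + \<pi> (g (\<pi> W)) - \<phi> (\<pi> (g (\<phi> (\<pi> W)))) = 0"
proof (intro ext)
  fix p and f :: "'m \<Rightarrow> real"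
  let ?R = "\<lambda>L W. at_point A (\<lambda>Y q. L Y q f *\<^sub>R W q) p"
  let ?L4 = "\<lambda>Y. - \<phi> (\<pi> (g Y))"
  have lin: "SF_linear (\<lambda>Y. \<phi> (g Y))" "SF_linear (\<lambda>Y. \<pi> (g Y))" "SF_linear ?L4"
    by (intro SF_linear_minus SF_linear_compose[OF linear(1)] SF_linear_compose[OF linear(2)] g)+
  have W': "\<phi> W \<in> VF" "\<pi> W \<in> VF" "\<phi> (\<pi> W) \<in> VF" by (intro closed W)+
  have R: "?R L Z v \<in> TM p" if "Z \<in> VF" for L Z v
    using subspace_scale[OF subspace_TM VF_TM[OF that]] by (simp add: at_point_def)
  define a b c d where abcd: "a = ?R g W" "b = ?R (\<lambda>Y. \<phi> (g Y)) (\<phi> W)"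
    "c = ?R (\<lambda>Y. \<pi> (g Y)) (\<pi> W)" "d = ?R ?L4 (\<phi> (\<pi> W))"
  have TM: "a v \<in> TM p" "b v \<in> TM p" "c v \<in> TM p" "d v \<in> TM p" for v
    unfolding abcd by (intro R W W')+
  \<comment> \<open>All occurrences of \<open>at_point\<close> select the same extension of
    \<open>v\<close>, so the decomposition holds as an equality of functions.\<close>
  have "at_point A (\<lambda>Y. apply_field (averaged_endo f W) (g Y)) p = (\<lambda>v. a v + b v + c v + d v)"
    by (simp add: fun_eq_iff abcd at_point_def apply_field_def averaged_endo_def)
  then have "endo_trace (TM p) a + endo_trace (TM p) b + endo_trace (TM p) c + endo_trace (TM p) d = 0"
    using tr[of p f] by (simp add: endo_trace_add subspace_add[OF subspace_TM] TM)
  then show "(g W + \<phi> (g (\<phi> W)) + \<pi> (g (\<pi> W)) - \<phi> (\<pi> (g (\<phi> (\<pi> W))))) p f = 0 p f"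
    unfolding abcd endo_trace_rank_one[OF g W] endo_trace_rank_one[OF lin(1) W'(1)]
      endo_trace_rank_one[OF lin(2) W'(2)] endo_trace_rank_one[OF lin(3) W'(3)]
    by simp
qed

text \<open>The derivative terms \<open>X p f\<close> of the two Leibniz rules cancel, so the
  difference is tensorial in the differentiated field as well.\<close>

lemma connection_difference:
  assumes D: "linear_connection A D" and D': "linear_connection A D'" and X: "X \<in> VF"
  shows "SF_linear (\<lambda>Y. D' X Y - D X Y)" "SF_linear (\<lambda>Y. D' Y X - D Y X)"
  unfolding SF_linear_def
  by (auto simp: X VF_diff connection_closed[OF D] connection_closed[OF D'] connection_add[OF D]
      connection_add[OF D'] connection_scale[OF D] connection_scale[OF D'] scaleR_diff_right fun_eq_iff)

theorem canonical_eq_well_adapted: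
  assumes can: "canonical_connection A F P D" and wa: "well_adapted_connection A F P D'"
    and "X \<in> VF" "Y \<in> VF"
  shows "D X Y = D' X Y"
proof -
  have D: "linear_connection A D" "parallel_endo A D F" "parallel_endo A D P"
    and D': "linear_connection A D'" "parallel_endo A D' F" "parallel_endo A D' P"
    using can wa by (auto simp: canonical_connection_def well_adapted_connection_def)
  define B where "B X Y = D' X Y - D X Y" for X Y
  have lin: "SF_linear (B X)" "SF_linear (\<lambda>Y. B Y X)" if "X \<in> VF" for X
    unfolding B_def using connection_difference[OF D(1) D'(1) that] by simp_all
  have BV: "B X Y \<in> VF" if "X \<in> VF" "Y \<in> VF" for X Y
    using SF_linearD(1)[OF lin(1)] that .
  have comm: "\<phi> (B X Y) = B X (\<phi> Y)" "\<pi> (B X Y) = B X (\<pi> Y)" if "X \<in> VF" "Y \<in> VF" for X Y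
    using that connection_closed[OF D(1)] connection_closed[OF D'(1)]
    by (simp_all add: B_def diff parallel[OF D(2)] parallel[OF D(3)] parallel[OF D'(2)] parallel[OF D'(3)])
  have tor: "torsion D' X Y = B X Y - B Y X" if "X \<in> VF" "Y \<in> VF" for X Y
  proof (intro ext)
    fix p and f :: "'m \<Rightarrow> real"
    have "torsion D X Y p f = 0" using canonical_torsion_free[OF can that] by simp
    then show "torsion D' X Y p f = (B X Y - B Y X) p f" by (simp add: torsion_def B_def)
  qed
  have eq: "B X W + B X W + B X W + B X W
      = B W X + B (\<phi> W) (\<phi> X) + B (\<pi> W) (\<pi> X) - B (\<phi> (\<pi> W)) (\<phi> (\<pi> X))"
    if X: "X \<in> VF" and W: "W \<in> VF" for X W
  proof -
    let ?g = "\<lambda>Y. B X Y - B Y X"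
    have g: "SF_linear ?g" by (rule SF_linear_subtract[OF lin[OF X]])
    have tr: "?g W + \<phi> (?g (\<phi> W)) + \<pi> (?g (\<pi> W)) - \<phi> (\<pi> (?g (\<phi> (\<pi> W)))) = 0"
    proof (rule trace_condition[OF g W])
      fix f p
      have "endo_trace (TM p) (at_point A (\<lambda>Y. apply_field (averaged_endo f W) (torsion D' X Y)) p) = 0"
        using wa X averaged_endo_adjoint[OF W] unfolding well_adapted_connection_def by blast
      moreover have "endo_trace (TM p) (at_point A (\<lambda>Y. apply_field (averaged_endo f W) (torsion D' X Y)) p)
          = endo_trace (TM p) (at_point A (\<lambda>Y. apply_field (averaged_endo f W) (?g Y)) p)"
        by (intro endo_trace_cong at_point_cong) (simp_all add: tor X)
      ultimately show "endo_trace (TM p) (at_point A (\<lambda>Y. apply_field (averaged_endo f W) (?g Y)) p) = 0"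
        by (rule trans[OF sym, rotated])
    qed
    \<comment> \<open>\<open>B X\<close> commutes with \<open>F\<close> and \<open>P\<close>, so
      each of the four summands contributes one copy of \<open>B X W\<close>; in the last one this
      relation compensates the minus sign.\<close>
    have "\<phi> (\<pi> (\<phi> (\<pi> W))) = - W"
      using W by (simp add: closed relations neg)
    then have "\<phi> (?g (\<phi> W)) = B X W - B (\<phi> W) (\<phi> X)" "\<pi> (?g (\<pi> W)) = B X W - B (\<pi> W) (\<pi> X)"
      "\<phi> (\<pi> (?g (\<phi> (\<pi> W)))) = - B X W - B (\<phi> (\<pi> W)) (\<phi> (\<pi> X))"
      using X W by (simp_all add: diff closed BV comm relations(1,2) SF_linear_uminus[OF lin(1)])
    note terms = this
    show ?thesis
    proof (intro ext)
      fix p and f :: "'m \<Rightarrow> real"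
      show "(B X W + B X W + B X W + B X W) p f
        = (B W X + B (\<phi> W) (\<phi> X) + B (\<pi> W) (\<pi> X) - B (\<phi> (\<pi> W)) (\<phi> (\<pi> X))) p f"
        using fun_cong[OF fun_cong[OF tr], of p f] unfolding terms by simp
    qed
  qed
  \<comment> \<open>The number \<open>c\<close> is 1 or -1, so both eigenbundles of \<open>F\<close>
    are treated together.\<close>
  have same: "B X W = 0"
    if X: "X \<in> VF" "\<phi> X = c *\<^sub>R X" and W: "W \<in> VF" "\<phi> W = c *\<^sub>R W" and c: "c * c = 1" for X W c
  proof -
    have bil: "B (a *\<^sub>R U) (a *\<^sub>R V) = (a * a) *\<^sub>R B U V" if "U \<in> VF" "V \<in> VF" for a U V
      using that by (simp add: SF_linear_cscale[OF lin(1)] SF_linear_cscale[OF lin(2)] VF_cscale)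
    have half: "B X W + B X W + B X W + B X W = B W X + B W X"
      if X: "X \<in> VF" "\<phi> X = c *\<^sub>R X" and W: "W \<in> VF" "\<phi> W = c *\<^sub>R W" for X W
    proof -
      have "\<phi> (\<pi> X) = (- c) *\<^sub>R \<pi> X" "\<phi> (\<pi> W) = (- c) *\<^sub>R \<pi> W"
        using X W by (simp_all add: relations SF_linear_cscale[OF linear(2)])
      \<comment> \<open>The eigenvalues enter squared. Hence the last two terms of \<open>eq\<close>
        cancel and the \<open>F\<close> term is a second copy of \<open>B W X\<close>.\<close>
      then have "B (\<phi> (\<pi> W)) (\<phi> (\<pi> X)) = B (\<pi> W) (\<pi> X)" "B (\<phi> W) (\<phi> X) = B W X"
        using X W c bil[of "\<pi> W" "\<pi> X" "- c"] bil[of W X c] by (simp_all add: closed)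
      then show ?thesis using eq[OF X(1) W(1)] by simp
    qed
    show ?thesis
    proof (intro ext)
      fix p and f :: "'m \<Rightarrow> real"
      show "B X W p f = 0 p f"
        \<comment> \<open>With b and b' the values of \<open>B X W\<close> and \<open>B W X\<close>,
          the relations 4 b = 2 b' and 4 b' = 2 b leave only b = 0.\<close>
        using fun_cong[OF fun_cong[OF half[OF X W]], of p f] fun_cong[OF fun_cong[OF half[OF W X]], of p f]
        by simp
    qed
  qed
  have opposite: "B X W = 0"
    if X: "X \<in> VF" "\<phi> X = c *\<^sub>R X" and W: "W \<in> VF" "\<phi> W = - (c *\<^sub>R W)" and c: "c * c = 1" for X W c
  proof -
    have "\<phi> (\<pi> W) = c *\<^sub>R \<pi> W"
      using W by (simp add: relations neg VF_cscale SF_linear_cscale[OF linear(2)])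
    then have "\<pi> (B X W) = 0"
      using same[OF X closed(2)[OF W(1)]] c by (simp add: comm X W)
    then have "\<pi> (\<pi> (B X W)) = 0" by (simp add: SF_linear_0[OF linear(2)])
    then show ?thesis by (simp add: relations BV X W)
  qed
  have eigen: "B X Y = 0" if X: "X \<in> VF" "\<phi> X = c *\<^sub>R X" and c: "c = 1 \<or> c = - 1" and Y: "Y \<in> VF" for X Y c
  proof (rule eigen_split_eq_0[where L="B X", OF Y])
    show "B X (Y + Z) = B X Y + B X Z" if "Y \<in> VF" "Z \<in> VF" for Y Z
      by (rule SF_linearD(2)[OF lin(1)[OF X(1)] that])
    show "B X Y = 0" if "Y \<in> VF" "\<phi> Y = Y" for Y
      using same[OF X that(1)] opposite[OF X that(1)] that(2) c by auto
    show "B X Y = 0" if "Y \<in> VF" "\<phi> Y = - Y" for Y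
      using same[OF X that(1)] opposite[OF X that(1)] that(2) c by auto
  qed
  have "B X Y = 0"
  proof (rule eigen_split_eq_0[where L="\<lambda>X. B X Y", OF assms(3)])
    show "B (X + Z) Y = B X Y + B Z Y" if "X \<in> VF" "Z \<in> VF" for X Z
      by (rule SF_linearD(2)[OF lin(2)[OF assms(4)] that])
  qed (use eigen[of _ 1] eigen[of _ "-1"] assms(4) in simp_all)
  then show ?thesis by (simp add: B_def)
qed

end

theorem theorem18:
  fixes A :: "('m::{t2_space, second_countable_topology}, 'e::euclidean_space) atlas"
    and F P :: "'m efield" and D D' :: "'m connection"
  assumes "smooth_manifold A"
    and "almost_biparacomplex A F P"
    and "canonical_connection A F P D"
    and "well_adapted_connection A F P D'"
    and "biparacomplex A F P"
  shows "\<forall>X\<in>vector_fields A. \<forall>Y\<in>vector_fields A. D X Y = D' X Y"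
proof -
  interpret biparacomplex_manifold A F P
    by unfold_locales (use assms in simp_all)
  show ?thesis by (intro ballI canonical_eq_well_adapted[OF assms(3,4)])
qed

end
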